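(* The Davis hyperbolic 4-manifold $M=\Gamma\backslash H^4$ has a unique fully symmetric spin structure.
   Context: The Davis hyperbolic 4-manifold is $M=\Gamma\backslash H^4$, where $\Gamma\subset \mathrm{SO}^+(4,1)$ is the torsion-free discrete group generated by the 120 side-pairing maps of a regular hyperbolic 120-cell $\mathcal C$ with dihedral angle $2\pi/5$ that glue each side of $\mathcal C$ to its opposite side by the hyperbolic translation whose axis passes through the center of $\mathcal C$. Let $\eta:\mathrm{Spin}^+(4,1)\to \mathrm{SO}^+(4,1)$ be the double covering epimorphism. A spin structure on $M$ is given by a subgroup $\hat\Gamma$ of $\mathrm{Spin}^+(4,1)$ mapped isomorphically onto $\Gamma$ by $\eta$, the spin structure being $\hat\Gamma\backslash \mathrm{Spin}^+(4,1)$. If $N(\Gamma)$ is the normalizer of $\Gamma$ in $\mathrm{SO}^+(4,1)$, the orientation-preserving isometries of $M$ are exactly the maps $f_\star(\Gamma x)=\Gamma fx$ with $f\in N(\Gamma)$; the symmetries of the spin structure are the maps $\hat f_\star(\hat\Gamma\hat g)=\hat\Gamma\hat f\hat g$ with $\hat f$ in the normalizer $N(\hat\Gamma)$ of $\hat\Gamma$ in $\mathrm{Spin}^+(4,1)$, and $\hat f_\star$ lifts $f_\star$ where $f=\eta(\hat f)$. The spin structure is fully symmetric if every orientation-preserving isometry of $M$ lifts to a symmetry of the spin structure. *)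

theory Defs
  imports Complex_Main "Jordan_Normal_Form.Matrix" "Jordan_Normal_Form.Determinant"
    "HOL-Combinatorics.Permutations"
begin

definition lform :: "real vec \<Rightarrow> real vec \<Rightarrow> real" where
  "lform x y = - (x $ 0 * y $ 0) + (\<Sum>i\<in>{1..4}. x $ i * y $ i)"

text \<open>SO^+(4,1): determinant one, preserving the Lorentzian form and the upper sheet
  (equivalently, positive (0,0) entry).\<close>
definition SO41p :: "real mat set" where
  "SO41p = {A \<in> carrier_mat 5 5. det A = 1
      \<and> (\<forall>x\<in>carrier_vec 5. \<forall>y\<in>carrier_vec 5. lform (A *\<^sub>v x) (A *\<^sub>v y) = lform x y)
      \<and> A $$ (0,0) > 0}"

definition phi :: real where "phi = (1 + sqrt 5) / 2"

definition emb4 :: "(nat \<Rightarrow> real) \<Rightarrow> real vec" where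
  "emb4 f = vec 5 (\<lambda>i. if i = 0 then 0 else f (i - 1))"

text \<open>The 120 outward unit normal directions of the sides of the 120-cell centered at the
  origin e0 of the hyperboloid model: the 120 vertices of the (unit) 600-cell
  (the unit icosians).\<close>
definition cell120_dirs :: "real vec set" where
  "cell120_dirs =
     {emb4 (\<lambda>k. if k = j then s else 0) | j s. j < 4 \<and> (s = 1 \<or> s = -1)}
   \<union> {emb4 (\<lambda>k. s k / 2) | s. \<forall>k<4. s k = 1 \<or> s k = -1}
   \<union> {emb4 (\<lambda>k. s k * ([phi, 1, 1 / phi, 0] ! (p k)) / 2) | s p.
        (\<forall>k<4. s k = 1 \<or> s k = -1) \<and> p permutes {0..<4} \<and> evenperm p}"

definition inner4 :: "real vec \<Rightarrow> real vec \<Rightarrow> real" where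
  "inner4 u v = (\<Sum>i\<in>{1..4}. u $ i * v $ i)"

text \<open>Outward (spacelike, unit) normal of the side with direction u of the 120-cell with
  inradius r (side hyperplane at hyperbolic distance r from the center e0).\<close>
definition side_normal :: "real \<Rightarrow> real vec \<Rightarrow> real vec" where
  "side_normal r u = vec 5 (\<lambda>i. if i = 0 then sinh r else cosh r * u $ i)"

definition cell120 :: "real \<Rightarrow> real vec set" where
  "cell120 r = {x \<in> carrier_vec 5. lform x x = -1 \<and> x $ 0 > 0
       \<and> (\<forall>u\<in>cell120_dirs. lform x (side_normal r u) \<le> 0)}"

text \<open>Two sides are adjacent iff their directions are neighbouring vertices of the 600-cell,
  i.e. have inner product phi/2 = cos (pi/5).  The dihedral angle theta between adjacent sides
  satisfies cos theta = - lform n1 n2 for the outward unit normals.\<close>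
definition dihedral_angle_is :: "real \<Rightarrow> real \<Rightarrow> bool" where
  "dihedral_angle_is r \<theta> \<longleftrightarrow> (\<forall>u\<in>cell120_dirs. \<forall>v\<in>cell120_dirs.
      inner4 u v = phi / 2 \<longrightarrow> - lform (side_normal r u) (side_normal r v) = cos \<theta>)"

definition davis_inradius :: real where
  "davis_inradius = (THE r. r > 0 \<and> dihedral_angle_is r (2 * pi / 5))"

text \<open>Hyperbolic translation by distance d along the geodesic through the center e0 in the
  (unit, spatial) direction u.\<close>
definition hyp_translation :: "real vec \<Rightarrow> real \<Rightarrow> real mat" where
  "hyp_translation u d = mat 5 5 (\<lambda>(i,j).
      (if i = j then 1 else 0)
      + (cosh d - 1) * ((if i = 0 \<and> j = 0 then 1 else 0) + u $ i * u $ j)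
      + sinh d * ((if i = 0 then u $ j else 0) + (if j = 0 then u $ i else 0)))"

text \<open>The 120 side-pairing maps: the translation by twice the inradius in direction u maps
  the side with direction -u onto the opposite side with direction u.\<close>
definition davis_side_pairings :: "real mat set" where
  "davis_side_pairings = {hyp_translation u (2 * davis_inradius) | u. u \<in> cell120_dirs}"

inductive_set gen_group :: "nat \<Rightarrow> 'a::comm_ring_1 mat set \<Rightarrow> 'a mat set"
  for n :: nat and S :: "'a mat set" where
  one: "1\<^sub>m n \<in> gen_group n S"
| mult: "g \<in> gen_group n S \<Longrightarrow> s \<in> S \<Longrightarrow> s * g \<in> gen_group n S"
| inv: "g \<in> gen_group n S \<Longrightarrow> s \<in> S \<Longrightarrow> t \<in> carrier_mat n n \<Longrightarrow> t * s = 1\<^sub>m n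
         \<Longrightarrow> t * g \<in> gen_group n S"

definition davis_Gamma :: "real mat set" where
  "davis_Gamma = gen_group 5 davis_side_pairings"

definition normalizer_in :: "'a::semiring_1 mat set \<Rightarrow> 'a mat set \<Rightarrow> 'a mat set" where
  "normalizer_in G H = {f \<in> G. (\<lambda>g. f * g) ` H = (\<lambda>g. g * f) ` H}"

section \<open>Spin^+(4,1) inside the Clifford algebra Cl(4,1) = M_4(C)\<close>

definition pauli1 :: "complex mat" where "pauli1 = mat_of_rows_list 2 [[0, 1], [1, 0]]"
definition pauli2 :: "complex mat" where "pauli2 = mat_of_rows_list 2 [[0, - \<i>], [\<i>, 0]]"
definition pauli3 :: "complex mat" where "pauli3 = mat_of_rows_list 2 [[1, 0], [0, -1]]"

definition kron2 :: "complex mat \<Rightarrow> complex mat \<Rightarrow> complex mat" where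
  "kron2 A B = mat 4 4 (\<lambda>(i,j). A $$ (i div 2, j div 2) * B $$ (i mod 2, j mod 2))"

text \<open>Generators of the Clifford algebra of the Lorentzian form:
  gamma a * gamma b + gamma b * gamma a = 2 lform(e_a,e_b) I.\<close>
definition gamma :: "nat \<Rightarrow> complex mat" where
  "gamma a = [\<i> \<cdot>\<^sub>m kron2 pauli3 (1\<^sub>m 2), kron2 pauli1 pauli1, kron2 pauli1 pauli2,
              kron2 pauli1 pauli3, kron2 pauli2 (1\<^sub>m 2)] ! a"

text \<open>Clifford embedding of a vector of R^{4,1}; cliff v * cliff v = lform v v * I.\<close>
definition cliff :: "real vec \<Rightarrow> complex mat" where
  "cliff v = mat 4 4 (\<lambda>(i,j). \<Sum>a<5. complex_of_real (v $ a) * gamma a $$ (i,j))"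

text \<open>Spin^+(4,1): products of an even number of spacelike unit vectors and an even number
  of timelike unit vectors, i.e. the group generated by products v w of two unit vectors of
  the same type.\<close>
inductive_set spin41p :: "complex mat set" where
  one: "1\<^sub>m 4 \<in> spin41p"
| mult: "g \<in> spin41p \<Longrightarrow> v \<in> carrier_vec 5 \<Longrightarrow> w \<in> carrier_vec 5
         \<Longrightarrow> lform v v = lform w w \<Longrightarrow> (lform v v = 1 \<or> lform v v = -1)
         \<Longrightarrow> g * (cliff v * cliff w) \<in> spin41p"

text \<open>The double covering epimorphism eta : Spin^+(4,1) -> SO^+(4,1):
  g (cliff v) g^{-1} = cliff (eta g v).\<close>
definition eta :: "complex mat \<Rightarrow> real mat" where
  "eta g = (THE A. A \<in> carrier_mat 5 5
              \<and> (\<forall>v\<in>carrier_vec 5. g * cliff v = cliff (A *\<^sub>v v) * g))"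

definition is_spin_structure :: "complex mat set \<Rightarrow> bool" where
  "is_spin_structure G \<longleftrightarrow>
     G \<subseteq> spin41p \<and> 1\<^sub>m 4 \<in> G \<and> (\<forall>g\<in>G. \<forall>h\<in>G. g * h \<in> G)
     \<and> (\<forall>g\<in>G. \<exists>h\<in>G. h * g = 1\<^sub>m 4)
     \<and> inj_on eta G \<and> eta ` G = davis_Gamma"

text \<open>Fully symmetric: every orientation preserving isometry f_* (f in N(Gamma)) lifts to a
  symmetry fhat_* of the spin structure, fhat in N(Ghat) with eta fhat = f.\<close>
definition fully_symmetric :: "complex mat set \<Rightarrow> bool" where
  "fully_symmetric G \<longleftrightarrow>
     (\<forall>f\<in>normalizer_in SO41p davis_Gamma. \<exists>fh\<in>normalizer_in spin41p G. eta fh = f)"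

end

theory Submission
  imports Defs
begin

text \<open>
  Put \<open>c = phi^2 = cosh r\<close> and \<open>s = phi * 5^(1/4) = sinh r\<close>, where \<open>r\<close> is the inradius. The side-pairing
  map in direction \<open>u\<close> has the two lifts \<open>S u\<close> and \<open>- S u\<close> with \<open>S u = - c + s * (u e0)\<close> in the
  Clifford algebra. In \<open>2 \<times> 2\<close> blocks the diagonal entries of \<open>S u\<close> are \<open>- c = 1 - sqrt 5 * phi\<close>, and
  the off-diagonal ones lie in \<open>5^(1/4) R\<close> with \<open>R = Z[1/2, sqrt 5, i]\<close>. Matrices whose diagonal
  blocks are congruent to the identity modulo \<open>sqrt 5\<close> and whose off-diagonal blocks lie in
  \<open>5^(1/4) R\<close> are closed under products and have trace in \<open>4 + sqrt 5 R\<close>. As 8 is not in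
  \<open>sqrt 5 R\<close>, the group generated by all \<open>S u\<close> contains no pair \<open>g\<close>, \<open>- g\<close>, so it is a spin
  structure; as the trace is invariant under conjugation, every lift of an element of the normalizer
  of the Davis group normalizes it.

  Conversely, let a fully symmetric spin structure contain \<open>eps u * S u\<close> with \<open>eps u = 1\<close> or
  \<open>eps u = - 1\<close>. The rotations of the 120-cell normalize the Davis group and permute the directions
  transitively, so \<open>eps\<close> is constant. The five cells around a ridge give a relation
  \<open>S u0 * S u1 * S u2 * S u3 * S u4 = 1\<close> of odd length, which excludes \<open>eps = - 1\<close>.
\<close>

section \<open>Clifford multiplication and reflections\<close>

text \<open>Existence asks for signs of the 120 lifts that are consistent with every relation of the
  Davis group. The congruence avoids any presentation: consistency means only that no product of the
  chosen lifts is the negative of another, and the trace modulo \<open>sqrt 5\<close> shows this for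
  all words at once. The ring contains 1/2 because the icosians have half-integral coordinates over
  Z[phi]; as 2 is a unit modulo \<open>sqrt 5\<close>, the traces 4 and -4 stay distinct. Traces are
  compared, not the congruence itself, because nothing is known about the entries of the lift of an
  arbitrary isometry, while conjugation by it preserves traces. The spin group is given by
  generators, so that an element of the normalizer has a lift at all is a Cartan-Dieudonne argument,
  in which reflections have to be taken in pairs of equal type. That a lift is determined up to sign
  comes from Schur's lemma together with the reversal norm. The 120 directions are handled as
  integer lists, which turns transitivity into a finite computation.\<close>

lemma lform_expand:
  "lform x y = - (x $ 0 * y $ 0) + x $ 1 * y $ 1 + x $ 2 * y $ 2 + x $ 3 * y $ 3 + x $ 4 * y $ 4"
proof -
  have "{1..4::nat} = {1, 2, 3, 4}" by auto
  then show ?thesis by (simp add: lform_def)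
qed

lemma less_4_cases: "i < (4::nat) \<longleftrightarrow> i = 0 \<or> i = 1 \<or> i = 2 \<or> i = 3"
  by auto

lemma less_5_cases: "i < (5::nat) \<longleftrightarrow> i = 0 \<or> i = 1 \<or> i = 2 \<or> i = 3 \<or> i = 4"
  by auto

lemma index_mult_mat_4:
  assumes "A \<in> carrier_mat 4 4" "B \<in> carrier_mat 4 4" "i < 4" "j < 4"
  shows "(A * B) $$ (i, j) = A $$ (i, 0) * B $$ (0, j) + A $$ (i, 1) * B $$ (1, j)
    + A $$ (i, 2) * B $$ (2, j) + A $$ (i, 3) * B $$ (3, j)"
  using assms by (simp add: scalar_prod_def eval_nat_numeral)

lemma index_mult_mat_vec_5:
  assumes "A \<in> carrier_mat 5 5" "v \<in> carrier_vec 5" "i < 5"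
  shows "(A *\<^sub>v v) $ i = A $$ (i, 0) * v $ 0 + A $$ (i, 1) * v $ 1
    + A $$ (i, 2) * v $ 2 + A $$ (i, 3) * v $ 3 + A $$ (i, 4) * v $ 4"
  using assms by (simp add: scalar_prod_def eval_nat_numeral)

lemma eq_mat_4I:
  assumes "A \<in> carrier_mat 4 4" "B \<in> carrier_mat 4 4"
    and "\<And>i j. i < 4 \<Longrightarrow> j < 4 \<Longrightarrow> A $$ (i, j) = B $$ (i, j)"
  shows "A = B"
  using assms by (intro eq_matI) auto

lemma eq_vec_5I:
  assumes "v \<in> carrier_vec 5" "w \<in> carrier_vec 5" "v $ 0 = w $ 0" "v $ 1 = w $ 1" "v $ 2 = w $ 2"
    "v $ 3 = w $ 3" "v $ 4 = w $ 4"
  shows "v = w"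
  using assms by (intro eq_vecI) (auto simp: less_5_cases)

lemma sum_less_5: "(\<Sum>a<5. f a) = f 0 + f 1 + f 2 + f 3 + f (4::nat)" for f :: "nat \<Rightarrow> 'a::comm_monoid_add"
  by (simp add: eval_nat_numeral add.assoc)

lemma cliff_carrier [simp]: "cliff v \<in> carrier_mat 4 4"
  by (simp add: cliff_def)

lemma cliff_dim [simp]: "dim_row (cliff v) = 4" "dim_col (cliff v) = 4"
  by (simp_all add: cliff_def)

text \<open>The time coordinate fills the diagonal 2x2 blocks and the space coordinates the
  off-diagonal ones; the congruence argument rests on this grading.\<close>

lemma cliff_index:
  "cliff v $$ (0, 0) = \<i> * v $ 0" "cliff v $$ (0, 1) = 0"
  "cliff v $$ (0, 2) = v $ 3 - \<i> * v $ 4" "cliff v $$ (0, 3) = v $ 1 - \<i> * v $ 2"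
  "cliff v $$ (1, 0) = 0" "cliff v $$ (1, 1) = \<i> * v $ 0"
  "cliff v $$ (1, 2) = v $ 1 + \<i> * v $ 2" "cliff v $$ (1, 3) = - v $ 3 - \<i> * v $ 4"
  "cliff v $$ (2, 0) = v $ 3 + \<i> * v $ 4" "cliff v $$ (2, 1) = v $ 1 - \<i> * v $ 2"
  "cliff v $$ (2, 2) = - \<i> * v $ 0" "cliff v $$ (2, 3) = 0"
  "cliff v $$ (3, 0) = v $ 1 + \<i> * v $ 2" "cliff v $$ (3, 1) = - v $ 3 + \<i> * v $ 4"
  "cliff v $$ (3, 2) = 0" "cliff v $$ (3, 3) = - \<i> * v $ 0"
  by (simp_all add: cliff_def gamma_def kron2_def pauli1_def pauli2_def pauli3_def
      mat_of_rows_list_def sum_less_5)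

lemma cliff_anticommute:
  "cliff v * cliff w + cliff w * cliff v = complex_of_real (2 * lform v w) \<cdot>\<^sub>m 1\<^sub>m 4"
  by (rule eq_mat_4I,
      simp_all add: add_carrier_mat[of _ 4 4] mult_carrier_mat[of _ 4 4] del: index_mult_mat(1),
      auto simp: less_4_cases index_mult_mat_4 cliff_index lform_expand complex_eq_iff algebra_simps
        simp del: index_mult_mat(1) One_nat_def)

text \<open>Sylvester's identity det (1 + XY) = det (1 + YX) for a column \<open>X\<close> and a row
  \<open>Y\<close>: the block matrix with rows (1, -Y) and (X, 1) is factored into triangular blocks
  in two ways.\<close>

lemma det_one_plus_outer:
  fixes x y :: "nat \<Rightarrow> 'a::idom"
  shows "det (mat n n (\<lambda>(i, j). (if i = j then 1 else 0) + x i * y j)) = 1 + (\<Sum>i<n. x i * y i)"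
proof -
  define m :: nat where "m = 1"
  define X where "X = mat n m (\<lambda>(i, _). x i)"
  define Y where "Y = mat m n (\<lambda>(_, j). y j)"
  have XY [simp]: "X \<in> carrier_mat n m" "Y \<in> carrier_mat m n" by (auto simp: X_def Y_def)
  have dims [simp]: "dim_row X = n" "dim_col X = m" "dim_row Y = m" "dim_col Y = n"
    by (auto simp: X_def Y_def)
  have outer: "mat n n (\<lambda>(i, j). (if i = j then 1 else 0) + x i * y j) = 1\<^sub>m n + X * Y"
    by (rule eq_matI) (auto simp: X_def Y_def m_def scalar_prod_def)
  have inner: "det (1\<^sub>m m + Y * X) = 1 + (\<Sum>i<n. x i * y i)"
    by (subst det_single) (auto simp: X_def Y_def m_def scalar_prod_def mult.commute atLeast0LessThan)
  let ?L = "four_block_mat (1\<^sub>m m) (0\<^sub>m m n) X (1\<^sub>m n)"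
  let ?U1 = "four_block_mat (1\<^sub>m m) (- Y) (0\<^sub>m n m) (1\<^sub>m n + X * Y)"
  let ?U2 = "four_block_mat (1\<^sub>m m + Y * X) (- Y) (0\<^sub>m n m) (1\<^sub>m n)"
  have YX: "1\<^sub>m m + Y * X + - (Y * X) = 1\<^sub>m m"
    by (intro eq_matI) (auto simp del: index_mult_mat(1))
  have XY': "- (X * Y) + (1\<^sub>m n + X * Y) = 1\<^sub>m n"
    by (intro eq_matI) (auto simp del: index_mult_mat(1))
  have XYn: "1\<^sub>m n + X * Y \<in> carrier_mat n n" and YXm: "1\<^sub>m m + Y * X \<in> carrier_mat m m"
    by (auto intro: mult_carrier_mat)
  have "?L * ?U1 = four_block_mat (1\<^sub>m m) (- Y) X (1\<^sub>m n)"
    by (subst mult_four_block_mat[where ?n1.0 = m and ?n2.0 = n and ?nr1.0 = m and ?nr2.0 = n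
          and ?nc1.0 = m and ?nc2.0 = n]) (auto simp: XY' XYn left_mult_one_mat[OF XYn])
  moreover have "?U2 * ?L = four_block_mat (1\<^sub>m m) (- Y) X (1\<^sub>m n)"
    by (subst mult_four_block_mat[where ?n1.0 = m and ?n2.0 = n and ?nr1.0 = m and ?nr2.0 = n
          and ?nc1.0 = m and ?nc2.0 = n]) (auto simp: YX YXm right_mult_one_mat[OF YXm])
  ultimately have "det ?L * det ?U1 = det ?U2 * det ?L"
    using XYn YXm by (metis det_mult four_block_carrier_mat one_carrier_mat)
  moreover have "det ?L = 1"
    by (subst det_four_block_mat_upper_right_zero) auto
  moreover have "det ?U1 = det (1\<^sub>m n + X * Y)"
    using XYn by (subst det_four_block_mat_lower_left_zero) auto
  moreover have "det ?U2 = det (1\<^sub>m m + Y * X)"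
    using YXm by (subst det_four_block_mat_lower_left_zero) auto
  ultimately show ?thesis by (simp add: outer inner)
qed

text \<open>Conjugation by \<open>cliff v\<close> acts on vectors as minus the reflection in the hyperplane
  orthogonal to \<open>v\<close>; in dimension 5 this map has determinant 1.\<close>
definition neg_reflection :: "real vec \<Rightarrow> real mat" where
  "neg_reflection v = mat 5 5 (\<lambda>(i, j). 2 / lform v v * v $ i * (if j = 0 then - v $ 0 else v $ j)
     - (if i = j then 1 else 0))"

lemma neg_reflection_carrier [simp]: "neg_reflection v \<in> carrier_mat 5 5"
  by (simp add: neg_reflection_def)

lemma neg_reflection_mult_vec:
  assumes "v \<in> carrier_vec 5" "x \<in> carrier_vec 5"
  shows "neg_reflection v *\<^sub>v x = (2 * lform v x / lform v v) \<cdot>\<^sub>v v - x"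
proof -
  define c where "c = 2 / lform v v"
  have index: "neg_reflection v $$ (i, j)
      = c * v $ i * (if j = 0 then - v $ 0 else v $ j) - (if i = j then 1 else 0)"
    if "i < 5" "j < 5" for i j
    using that by (simp add: neg_reflection_def c_def)
  have "neg_reflection v *\<^sub>v x = (c * lform v x) \<cdot>\<^sub>v v - x"
    using assms
    by (intro eq_vec_5I)
      (simp_all add: index_mult_mat_vec_5 index lform_expand algebra_simps
        mult_mat_vec_carrier[of _ 5 5] del: index_mult_mat_vec)
  then show ?thesis by (simp add: c_def)
qed

lemma lform_commute: "lform x y = lform y x"
  by (simp add: lform_expand mult.commute)

lemma lform_lincomb:
  assumes "v \<in> carrier_vec 5" "x \<in> carrier_vec 5" "y \<in> carrier_vec 5"
  shows "lform (a \<cdot>\<^sub>v v - x) y = a * lform v y - lform x y"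
    and "lform y (a \<cdot>\<^sub>v v - x) = a * lform y v - lform y x"
  using assms by (simp_all add: lform_expand algebra_simps)

lemma lform_neg_reflection:
  assumes "v \<in> carrier_vec 5" "x \<in> carrier_vec 5" "y \<in> carrier_vec 5" "lform v v \<noteq> 0"
  shows "lform (neg_reflection v *\<^sub>v x) (neg_reflection v *\<^sub>v y) = lform x y"
  using assms
  by (simp add: neg_reflection_mult_vec lform_lincomb field_simps
      lform_commute[of x v] lform_commute[of y v] lform_commute[of y x])

text \<open>The reflection is 1 plus a matrix of rank one and has determinant -1; the scalar -1
  contributes (-1)^5.\<close>

lemma det_neg_reflection:
  assumes "v \<in> carrier_vec 5" "lform v v \<noteq> 0"
  shows "det (neg_reflection v) = 1"
proof -
  let ?M = "mat 5 5 (\<lambda>(i, j). (if i = j then 1 else 0)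
    + (- 2 / lform v v * v $ i) * (if j = 0 then - v $ 0 else v $ j))"
  have "neg_reflection v = (- 1) \<cdot>\<^sub>m ?M"
    by (rule eq_matI) (auto simp: neg_reflection_def)
  moreover have "det ?M = - 1"
  proof -
    have "(\<Sum>i<5. (c * v $ i) * (if i = 0 then - v $ 0 else v $ i)) = c * lform v v" for c
      by (simp add: lform_expand sum_less_5 algebra_simps)
    from this[of "- 2 / lform v v"] assms(2) show ?thesis
      by (subst det_one_plus_outer) (simp only: nonzero_mult_div_cancel_right times_divide_eq_left, simp)
  qed
  ultimately show ?thesis by simp
qed

lemma cliff_square: "cliff v * cliff v = complex_of_real (lform v v) \<cdot>\<^sub>m 1\<^sub>m 4"
proof (rule eq_mat_4I)
  fix i j :: nat assume "i < 4" "j < 4"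
  then have "(cliff v * cliff v + cliff v * cliff v) $$ (i, j)
     = (complex_of_real (2 * lform v v) \<cdot>\<^sub>m 1\<^sub>m 4) $$ (i, j)"
    by (simp only: cliff_anticommute)
  with \<open>i < 4\<close> \<open>j < 4\<close> show "(cliff v * cliff v) $$ (i, j) = (complex_of_real (lform v v) \<cdot>\<^sub>m 1\<^sub>m 4) $$ (i, j)"
    by (auto simp del: index_mult_mat(1) split: if_splits)
qed (auto intro: mult_carrier_mat[of _ 4 4])

lemma cliff_lincomb:
  assumes "v \<in> carrier_vec 5" "x \<in> carrier_vec 5"
  shows "cliff (a \<cdot>\<^sub>v v - x) = complex_of_real a \<cdot>\<^sub>m cliff v - cliff x"
  using assms by (intro eq_mat_4I) (auto simp: less_4_cases cliff_index algebra_simps minus_carrier_mat simp del: One_nat_def)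

text \<open>The Clifford relation gives v x = 2 (v, x) - x v. Writing the scalar 2 (v, x) as a
  multiple of v v lets a factor v split off on the right.\<close>

lemma cliff_neg_reflection:
  assumes "v \<in> carrier_vec 5" "x \<in> carrier_vec 5" "lform v v \<noteq> 0"
  shows "cliff v * cliff x = cliff (neg_reflection v *\<^sub>v x) * cliff v"
proof -
  define c where "c = 2 * lform v x / lform v v"
  have "cliff (neg_reflection v *\<^sub>v x) * cliff v
      = complex_of_real c \<cdot>\<^sub>m (cliff v * cliff v) - cliff x * cliff v"
    using assms(1,2)
    by (simp add: neg_reflection_mult_vec c_def[symmetric] cliff_lincomb
        minus_mult_distrib_mat[of _ 4 4 _ _ 4]
        mult_smult_assoc_mat[of _ 4 4 _ 4])
  also have "complex_of_real c \<cdot>\<^sub>m (cliff v * cliff v) = complex_of_real (2 * lform v x) \<cdot>\<^sub>m 1\<^sub>m 4"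
    using assms(3) by (intro eq_matI) (auto simp: cliff_square c_def)
  also have "\<dots> = cliff v * cliff x + cliff x * cliff v"
    by (simp add: cliff_anticommute)
  also have "\<dots> - cliff x * cliff v = cliff v * cliff x"
    by (rule eq_matI) (auto simp del: index_mult_mat(1))
  finally show ?thesis by simp
qed

lemma cliff_inj:
  assumes "v \<in> carrier_vec 5" "w \<in> carrier_vec 5" "cliff v = cliff w"
  shows "v = w"
proof -
  have "cliff v $$ (i, j) = cliff w $$ (i, j)" for i j using assms(3) by simp
  from this[of 0 0] this[of 0 2] this[of 0 3] show ?thesis
    using assms(1,2) by (intro eq_vec_5I) (auto simp: cliff_index complex_eq_iff)
qed

section \<open>The covering of the rotation group and its kernel\<close>

lemma spin41p_carrier: "g \<in> spin41p \<Longrightarrow> g \<in> carrier_mat 4 4"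
  by (induction rule: spin41p.induct) (auto intro!: mult_carrier_mat[of _ 4 4])

lemma spin41p_mult: "h \<in> spin41p \<Longrightarrow> g \<in> spin41p \<Longrightarrow> g * h \<in> spin41p"
proof (induction rule: spin41p.induct)
  case one
  then show ?case using right_mult_one_mat[OF spin41p_carrier[OF one]] by simp
next
  case (mult h v w)
  have "g * (h * (cliff v * cliff w)) = g * h * (cliff v * cliff w)"
    using mult by (intro assoc_mult_mat[symmetric, of _ 4 4 _ 4 _ 4])
      (auto intro: spin41p_carrier mult_carrier_mat[of _ 4 4])
  with mult show ?case by (metis spin41p.mult)
qed

lemma spin41p_pair:
  assumes "v \<in> carrier_vec 5" "w \<in> carrier_vec 5" "lform v v = lform w w" "lform v v = 1 \<or> lform v v = - 1"
  shows "cliff v * cliff w \<in> spin41p"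
proof -
  have "1\<^sub>m 4 * (cliff v * cliff w) \<in> spin41p" using assms by (intro spin41p.mult spin41p.one)
  then show ?thesis by (simp add: left_mult_one_mat[of _ 4 4] mult_carrier_mat[of _ 4 4])
qed

text \<open>In v w w v the inner square is a scalar, and both squares are the same sign, so their
  product is 1. Here the two factors have to be of equal type.\<close>

lemma cliff_pair_inverse:
  assumes "lform v v = lform w w" "lform v v = 1 \<or> lform v v = - 1"
  shows "cliff v * cliff w * (cliff w * cliff v) = 1\<^sub>m 4"
proof -
  have "cliff v * cliff w * (cliff w * cliff v) = cliff v * (cliff w * cliff w) * cliff v"
    by (simp add: assoc_mult_mat[of _ 4 4 _ 4 _ 4] mult_carrier_mat[of _ 4 4])
  also have "\<dots> = complex_of_real (lform w w) \<cdot>\<^sub>m (cliff v * cliff v)"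
    by (simp add: cliff_square mult_smult_distrib[of _ 4 4 _ 4] mult_smult_assoc_mat[of _ 4 4 _ 4])
  also have "\<dots> = 1\<^sub>m 4"
    using assms by (intro eq_matI) (auto simp: cliff_square)
  finally show ?thesis .
qed

lemma mult_mat_cancel_middle:
  fixes a b c d :: "'a::semiring_1 mat"
  assumes "a \<in> carrier_mat n n" "b \<in> carrier_mat n n" "c \<in> carrier_mat n n" "d \<in> carrier_mat n n"
    and "b * c = 1\<^sub>m n"
  shows "a * b * (c * d) = a * d"
proof -
  have "a * b * (c * d) = a * (b * c) * d"
    using assms(1-4) by (simp add: assoc_mult_mat[of _ n n _ n _ n] mult_carrier_mat[of _ n n])
  then show ?thesis using assms by simp
qed

lemma spin41p_inverse: "g \<in> spin41p \<Longrightarrow> \<exists>h\<in>spin41p. g * h = 1\<^sub>m 4 \<and> h * g = 1\<^sub>m 4"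
proof (induction rule: spin41p.induct)
  case one
  then show ?case by (intro bexI[of _ "1\<^sub>m 4"]) (auto intro: spin41p.one)
next
  case (mult g v w)
  then obtain h where h: "h \<in> spin41p" "g * h = 1\<^sub>m 4" "h * g = 1\<^sub>m 4" by blast
  note carr = spin41p_carrier[OF h(1)] spin41p_carrier[OF mult.hyps(1)]
  let ?p = "cliff v * cliff w" and ?q = "cliff w * cliff v"
  have pq: "?p * ?q = 1\<^sub>m 4" "?q * ?p = 1\<^sub>m 4"
    using mult.hyps by (simp_all add: cliff_pair_inverse)
  have q: "?q \<in> spin41p" and p: "?p \<in> spin41p"
    using mult.hyps by (auto intro!: spin41p_pair)
  note carr = carr spin41p_carrier[OF p] spin41p_carrier[OF q]
  have 1: "g * ?p * (?q * h) = 1\<^sub>m 4" and "?q * h * (g * ?p) = 1\<^sub>m 4"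
    using h pq carr by (simp_all only: mult_mat_cancel_middle[of _ 4])
  with 1 spin41p_mult[OF h(1) q] show ?case by blast
qed

text \<open>SO(4,1) without the choice of a sheet. A single \<open>neg_reflection\<close> with
  spacelike \<open>v\<close> interchanges the sheets, so it lies in this group but not in
  \<open>SO41p\<close>; products of pairs can thus be treated factor by factor.\<close>

definition proper_isometry :: "real mat \<Rightarrow> bool" where
  "proper_isometry A \<longleftrightarrow> A \<in> carrier_mat 5 5 \<and> det A = 1
     \<and> (\<forall>x\<in>carrier_vec 5. \<forall>y\<in>carrier_vec 5. lform (A *\<^sub>v x) (A *\<^sub>v y) = lform x y)"

lemma proper_isometry_mult:
  assumes "proper_isometry A" "proper_isometry B"
  shows "proper_isometry (A * B)"
proof -
  have [simp]: "A \<in> carrier_mat 5 5" "B \<in> carrier_mat 5 5"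
    using assms by (auto simp: proper_isometry_def)
  have "B *\<^sub>v x \<in> carrier_vec 5" if "x \<in> carrier_vec 5" for x
    using that by (rule mult_mat_vec_carrier[rotated]) simp
  then show ?thesis
    using assms by (auto simp: proper_isometry_def det_mult[of A 5] mult_carrier_mat[of _ 5 5] assoc_mult_mat_vec[of _ 5 5 _ 5])
qed

lemma proper_isometry_neg_reflection:
  "v \<in> carrier_vec 5 \<Longrightarrow> lform v v \<noteq> 0 \<Longrightarrow> proper_isometry (neg_reflection v)"
  by (simp add: proper_isometry_def det_neg_reflection lform_neg_reflection)

lemma proper_isometry_one: "proper_isometry (1\<^sub>m 5)"
  by (simp add: proper_isometry_def)

text \<open>The property that \<open>eta\<close> selects with \<open>THE\<close>, as a relation. It
  makes sense for single vectors too, which are not in \<open>spin41p\<close>, and it is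
  multiplicative before uniqueness is known.\<close>

definition intertwines :: "complex mat \<Rightarrow> real mat \<Rightarrow> bool" where
  "intertwines g A \<longleftrightarrow> A \<in> carrier_mat 5 5
     \<and> (\<forall>v\<in>carrier_vec 5. g * cliff v = cliff (A *\<^sub>v v) * g)"

lemma intertwines_mult:
  assumes "intertwines g A" "intertwines h B" "g \<in> carrier_mat 4 4" "h \<in> carrier_mat 4 4"
  shows "intertwines (g * h) (A * B)"
  unfolding intertwines_def
proof (intro conjI ballI)
  have AB: "A \<in> carrier_mat 5 5" "B \<in> carrier_mat 5 5" using assms by (auto simp: intertwines_def)
  then show "A * B \<in> carrier_mat 5 5" by simp
  fix v :: "real vec" assume v: "v \<in> carrier_vec 5"
  then have Bv: "B *\<^sub>v v \<in> carrier_vec 5" using AB by simp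
  have "g * h * cliff v = g * (h * cliff v)"
    using assms by (intro assoc_mult_mat[of _ 4 4 _ 4 _ 4]) auto
  also have "\<dots> = g * (cliff (B *\<^sub>v v) * h)"
    using assms(2) v by (simp add: intertwines_def)
  also have "\<dots> = g * cliff (B *\<^sub>v v) * h"
    using assms by (intro assoc_mult_mat[symmetric, of _ 4 4 _ 4 _ 4]) auto
  also have "\<dots> = cliff (A *\<^sub>v (B *\<^sub>v v)) * g * h"
    using assms(1) Bv by (simp add: intertwines_def)
  also have "\<dots> = cliff (A *\<^sub>v (B *\<^sub>v v)) * (g * h)"
    using assms by (intro assoc_mult_mat[of _ 4 4 _ 4 _ 4]) auto
  finally show "g * h * cliff v = cliff (A * B *\<^sub>v v) * (g * h)"
    using AB v by (simp add: assoc_mult_mat_vec[of _ 5 5 _ 5])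
qed

lemma intertwines_cliff:
  "v \<in> carrier_vec 5 \<Longrightarrow> lform v v \<noteq> 0 \<Longrightarrow> intertwines (cliff v) (neg_reflection v)"
  by (simp add: intertwines_def cliff_neg_reflection)

lemma intertwines_one: "intertwines (1\<^sub>m 4) (1\<^sub>m 5)"
  by (simp add: intertwines_def left_mult_one_mat[of _ 4 4] right_mult_one_mat[of _ 4 4])

lemma mat_eq_if_mult_vec_eq:
  fixes A B :: "'a::comm_semiring_1 mat"
  assumes "A \<in> carrier_mat m n" "B \<in> carrier_mat m n"
    and "\<And>v. v \<in> carrier_vec n \<Longrightarrow> A *\<^sub>v v = B *\<^sub>v v"
  shows "A = B"
proof (rule eq_matI)
  fix i j assume "i < dim_row B" "j < dim_col B"
  with assms have "i < m" "j < n" by auto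
  then have "A $$ (i, j) = (A *\<^sub>v unit_vec n j) $ i" "B $$ (i, j) = (B *\<^sub>v unit_vec n j) $ i"
    using assms(1,2) by auto
  with assms(3) show "A $$ (i, j) = B $$ (i, j)" by simp
qed (use assms in auto)

lemma intertwines_unique:
  assumes "g \<in> spin41p" "intertwines g A" "intertwines g B"
  shows "A = B"
proof (rule mat_eq_if_mult_vec_eq)
  show AB: "A \<in> carrier_mat 5 5" "B \<in> carrier_mat 5 5" using assms by (auto simp: intertwines_def)
  obtain h where h: "h \<in> spin41p" "g * h = 1\<^sub>m 4" using spin41p_inverse[OF assms(1)] by blast
  note carr = spin41p_carrier[OF h(1)] spin41p_carrier[OF assms(1)]
  fix v :: "real vec" assume v: "v \<in> carrier_vec 5"
  then have "cliff (A *\<^sub>v v) * g * h = cliff (B *\<^sub>v v) * g * h"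
    using assms(2,3) by (simp add: intertwines_def)
  then have "cliff (A *\<^sub>v v) * (g * h) = cliff (B *\<^sub>v v) * (g * h)"
    using carr by (simp add: assoc_mult_mat[of _ 4 4 _ 4 _ 4])
  then have "cliff (A *\<^sub>v v) = cliff (B *\<^sub>v v)"
    by (simp add: h right_mult_one_mat[of _ 4 4])
  then show "A *\<^sub>v v = B *\<^sub>v v" using AB v by (intro cliff_inj) auto
qed

lemma eta_eqI: "g \<in> spin41p \<Longrightarrow> intertwines g A \<Longrightarrow> eta g = A"
  unfolding eta_def using intertwines_unique[of g]
  by (intro the_equality) (auto simp: intertwines_def)

lemma spin41p_intertwines: "g \<in> spin41p \<Longrightarrow> \<exists>A. intertwines g A \<and> proper_isometry A"
proof (induction rule: spin41p.induct)
  case one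
  then show ?case using intertwines_one proper_isometry_one by blast
next
  case (mult g v w)
  then obtain A where A: "intertwines g A" "proper_isometry A" by blast
  have "lform v v \<noteq> 0" "lform w w \<noteq> 0" using mult.hyps by auto
  then have "intertwines (g * (cliff v * cliff w)) (A * (neg_reflection v * neg_reflection w))"
    "proper_isometry (A * (neg_reflection v * neg_reflection w))"
    using mult.hyps A spin41p_carrier
    by (auto intro!: intertwines_mult proper_isometry_mult intertwines_cliff
        proper_isometry_neg_reflection mult_carrier_mat[of _ 4 4])
  then show ?case by blast
qed

lemma intertwines_eta: "g \<in> spin41p \<Longrightarrow> intertwines g (eta g)"
  using spin41p_intertwines eta_eqI by blast

lemma proper_isometry_eta: "g \<in> spin41p \<Longrightarrow> proper_isometry (eta g)"
  using spin41p_intertwines eta_eqI by blast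

lemma eta_carrier: "g \<in> spin41p \<Longrightarrow> eta g \<in> carrier_mat 5 5"
  using intertwines_eta by (simp add: intertwines_def)

lemma eta_mult: "g \<in> spin41p \<Longrightarrow> h \<in> spin41p \<Longrightarrow> eta (g * h) = eta g * eta h"
  by (intro eta_eqI intertwines_mult intertwines_eta spin41p_mult spin41p_carrier)

lemma eta_one: "eta (1\<^sub>m 4) = 1\<^sub>m 5"
  by (intro eta_eqI spin41p.one intertwines_one)

lemma eta_pair:
  assumes "v \<in> carrier_vec 5" "w \<in> carrier_vec 5" "lform v v = lform w w" "lform v v = 1 \<or> lform v v = - 1"
  shows "eta (cliff v * cliff w) = neg_reflection v * neg_reflection w"
  using assms by (intro eta_eqI spin41p_pair intertwines_mult intertwines_cliff) auto

text \<open>This matrix conjugates transposition into the reversal anti-automorphism of the Clifford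
  algebra.\<close>
definition reversal_mat :: "complex mat" where
  "reversal_mat = kron2 pauli3 pauli2"

lemma reversal_mat_carrier [simp]: "reversal_mat \<in> carrier_mat 4 4"
  by (simp add: reversal_mat_def kron2_def)

lemma reversal_mat_dim [simp]: "dim_row reversal_mat = 4" "dim_col reversal_mat = 4"
  by (simp_all add: reversal_mat_def kron2_def)

lemma reversal_mat_index:
  "reversal_mat $$ (0, 0) = 0" "reversal_mat $$ (0, 1) = - \<i>" "reversal_mat $$ (0, 2) = 0" "reversal_mat $$ (0, 3) = 0"
  "reversal_mat $$ (1, 0) = \<i>" "reversal_mat $$ (1, 1) = 0" "reversal_mat $$ (1, 2) = 0" "reversal_mat $$ (1, 3) = 0"
  "reversal_mat $$ (2, 0) = 0" "reversal_mat $$ (2, 1) = 0" "reversal_mat $$ (2, 2) = 0" "reversal_mat $$ (2, 3) = \<i>"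
  "reversal_mat $$ (3, 0) = 0" "reversal_mat $$ (3, 1) = 0" "reversal_mat $$ (3, 2) = - \<i>" "reversal_mat $$ (3, 3) = 0"
  by (simp_all add: reversal_mat_def kron2_def pauli2_def pauli3_def mat_of_rows_list_def)

lemma cliff_reversal: "reversal_mat * transpose_mat (cliff v) = cliff v * reversal_mat"
  by (rule eq_mat_4I)
    (auto simp: less_4_cases index_mult_mat_4 cliff_index reversal_mat_index
      mult_carrier_mat[of _ 4 4] algebra_simps simp del: index_mult_mat(1) One_nat_def)

text \<open>This is the reversal norm: with J = \<open>reversal_mat\<close>, the matrix J g^t J^-1
  is the reversed word of g, and a word times its reverse telescopes to a product of squares, which
  are equal in pairs. It is the constraint that leaves only 1 and -1 among the complex
  scalars.\<close>

lemma spin41p_reversal: "g \<in> spin41p \<Longrightarrow> g * reversal_mat * transpose_mat g = reversal_mat"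
proof (induction rule: spin41p.induct)
  case one
  then show ?case by (simp add: right_mult_one_mat[of _ 4 4] left_mult_one_mat[of _ 4 4])
next
  case (mult g v w)
  let ?J = reversal_mat and ?t = "transpose_mat :: complex mat \<Rightarrow> complex mat"
  note [simp] = spin41p_carrier[OF mult.hyps(1)]
  have ass: "a * b * c = a * (b * c)"
    if "a \<in> carrier_mat 4 4" "b \<in> carrier_mat 4 4" "c \<in> carrier_mat 4 4" for a b c :: "complex mat"
    using that by (rule assoc_mult_mat)
  have t [simp]: "?t a \<in> carrier_mat 4 4" if "a \<in> carrier_mat 4 4" for a using that by simp
  have m [simp]: "a * b \<in> carrier_mat 4 4" if "a \<in> carrier_mat 4 4" "b \<in> carrier_mat 4 4" for a b :: "complex mat"
    using that by simp
  have "g * (cliff v * cliff w) * ?J * ?t (g * (cliff v * cliff w))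
      = g * (cliff v * ((cliff w * ?J) * ?t (cliff w)) * ?t (cliff v)) * ?t g"
    by (simp add: transpose_mult[of _ 4 4 _ 4] ass)
  also have "(cliff w * ?J) * ?t (cliff w) = cliff w * (?J * ?t (cliff w))"
    by (simp add: ass)
  also have "\<dots> = complex_of_real (lform w w) \<cdot>\<^sub>m ?J"
    by (simp add: cliff_reversal cliff_square mult_smult_assoc_mat[of _ 4 4 _ 4]
        left_mult_one_mat[of _ 4 4] flip: ass)
  also have "cliff v * (complex_of_real (lform w w) \<cdot>\<^sub>m ?J) * ?t (cliff v)
     = complex_of_real (lform w w) \<cdot>\<^sub>m (cliff v * (?J * ?t (cliff v)))"
    by (simp add: mult_smult_assoc_mat[of _ 4 4 _ 4] mult_smult_distrib[of _ 4 4 _ 4] ass)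
  also have "cliff v * (?J * ?t (cliff v)) = complex_of_real (lform v v) \<cdot>\<^sub>m ?J"
    by (simp add: cliff_reversal cliff_square mult_smult_assoc_mat[of _ 4 4 _ 4]
        left_mult_one_mat[of _ 4 4] flip: ass)
  also have "complex_of_real (lform w w) \<cdot>\<^sub>m (complex_of_real (lform v v) \<cdot>\<^sub>m ?J) = ?J"
    using mult.hyps by (intro eq_matI) auto
  finally show ?case using mult.IH by simp
qed

text \<open>Schur's lemma by hand: commuting with \<open>gamma 0\<close> kills the off-diagonal
  blocks, \<open>gamma 4\<close> identifies the two diagonal blocks, \<open>gamma 3\<close> makes
  them diagonal and \<open>gamma 1\<close> scalar.\<close>

lemma cliff_commutant:
  assumes g: "g \<in> carrier_mat 4 4" and comm: "\<And>v. v \<in> carrier_vec 5 \<Longrightarrow> g * cliff v = cliff v * g"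
  shows "g = g $$ (0, 0) \<cdot>\<^sub>m 1\<^sub>m 4"
proof -
  have e: "(g * cliff (unit_vec 5 a)) $$ (i, j) = (cliff (unit_vec 5 a) * g) $$ (i, j)" for a i j
    by (simp add: comm)
  have c0: "g $$ (0,2) = 0" "g $$ (0,3) = 0" "g $$ (1,2) = 0" "g $$ (1,3) = 0"
      "g $$ (2,0) = 0" "g $$ (2,1) = 0" "g $$ (3,0) = 0" "g $$ (3,1) = 0"
    using e[of 0 0 2] e[of 0 0 3] e[of 0 1 2] e[of 0 1 3] e[of 0 2 0] e[of 0 2 1] e[of 0 3 0] e[of 0 3 1] g
    by (simp_all add: index_mult_mat_4 cliff_index del: index_mult_mat(1) One_nat_def)
  have c4: "g $$ (2,2) = g $$ (0,0)" "g $$ (2,3) = g $$ (0,1)" "g $$ (3,2) = g $$ (1,0)" "g $$ (3,3) = g $$ (1,1)"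
    using e[of 4 0 2] e[of 4 0 3] e[of 4 1 2] e[of 4 1 3] g
    by (simp_all add: index_mult_mat_4 cliff_index del: index_mult_mat(1) One_nat_def)
  have c3: "g $$ (0,1) = 0" "g $$ (1,0) = 0"
    using e[of 3 0 3] e[of 3 1 2] g c0 c4
    by (simp_all add: index_mult_mat_4 cliff_index del: index_mult_mat(1) One_nat_def)
  have c1: "g $$ (1,1) = g $$ (0,0)"
    using e[of 1 0 3] g c0 c4 c3
    by (simp_all add: index_mult_mat_4 cliff_index del: index_mult_mat(1) One_nat_def)
  show ?thesis
    using g by (intro eq_mat_4I) (auto simp: less_4_cases c0 c4 c3 c1 simp del: One_nat_def)
qed

text \<open>The quotient h^-1 g commutes with all vectors, hence is a scalar c, and the reversal
  norm forces c^2 = 1.\<close>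

lemma eta_eq_imp:
  assumes g: "g \<in> spin41p" and h: "h \<in> spin41p" and eq: "eta g = eta h"
  shows "g = h \<or> g = - h"
proof -
  obtain k where k: "k \<in> spin41p" "h * k = 1\<^sub>m 4" "k * h = 1\<^sub>m 4" using spin41p_inverse[OF h] by blast
  note [simp] = spin41p_carrier[OF g] spin41p_carrier[OF h] spin41p_carrier[OF k(1)]
  have ass: "a * b * c = a * (b * c)"
    if "a \<in> carrier_mat 4 4" "b \<in> carrier_mat 4 4" "c \<in> carrier_mat 4 4" for a b c :: "complex mat"
    using that by (rule assoc_mult_mat)
  let ?z = "k * g"
  have z: "?z \<in> spin41p" using spin41p_mult g k by blast
  note [simp] = spin41p_carrier[OF z]
  have "eta ?z = eta (k * h)" using g h k(1) eq by (simp add: eta_mult)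
  then have "eta ?z = 1\<^sub>m 5" by (simp add: k eta_one)
  then have "?z * cliff v = cliff v * ?z" if "v \<in> carrier_vec 5" for v
    using intertwines_eta[OF z] that by (simp add: intertwines_def)
  then have c: "?z = ?z $$ (0, 0) \<cdot>\<^sub>m 1\<^sub>m 4" by (intro cliff_commutant) auto
  define c where "c = ?z $$ (0, 0)"
  have "reversal_mat = (c \<cdot>\<^sub>m 1\<^sub>m 4) * reversal_mat * transpose_mat (c \<cdot>\<^sub>m 1\<^sub>m 4)"
    using spin41p_reversal[OF z] c by (simp add: c_def)
  also have "transpose_mat (c \<cdot>\<^sub>m 1\<^sub>m 4) = c \<cdot>\<^sub>m 1\<^sub>m 4"
    by (intro eq_matI) auto
  also have "(c \<cdot>\<^sub>m 1\<^sub>m 4) * reversal_mat * (c \<cdot>\<^sub>m 1\<^sub>m 4) = (c * c) \<cdot>\<^sub>m reversal_mat"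
    by (intro eq_mat_4I) (auto simp: less_4_cases index_mult_mat_4
      mult_carrier_mat[of _ 4 4] simp del: index_mult_mat(1) One_nat_def)
  finally have "reversal_mat $$ (1, 0) = ((c * c) \<cdot>\<^sub>m reversal_mat) $$ (1, 0)" by simp
  then have "c * c = 1"
    using reversal_mat_carrier by (simp add: reversal_mat_index del: One_nat_def)
  then have c1: "c = 1 \<or> c = - 1" by (simp add: square_eq_1_iff)
  have "g = h * k * g" using k by (simp add: left_mult_one_mat[of _ 4 4])
  also have "\<dots> = h * ?z" by (simp add: ass)
  also have "\<dots> = h * (c \<cdot>\<^sub>m 1\<^sub>m 4)" using c by (simp add: c_def)
  also have "\<dots> = c \<cdot>\<^sub>m h" by (simp add: mult_smult_distrib[of _ 4 4 _ 4] right_mult_one_mat[of _ 4 4])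
  finally show ?thesis
    using c1 by (auto intro!: eq_matI)
qed

section \<open>Surjectivity of the covering\<close>

lemma lform_smult:
  assumes "x \<in> carrier_vec 5" "y \<in> carrier_vec 5"
  shows "lform (a \<cdot>\<^sub>v x) (b \<cdot>\<^sub>v y) = a * b * lform x y"
  using assms by (simp add: lform_expand algebra_simps)

lemma neg_reflection_smult:
  assumes "v \<in> carrier_vec 5" "c \<noteq> 0"
  shows "neg_reflection (c \<cdot>\<^sub>v v) = neg_reflection v"
proof (rule mat_eq_if_mult_vec_eq[where m = 5 and n = 5])
  fix x :: "real vec" assume x: "x \<in> carrier_vec 5"
  have "lform (c \<cdot>\<^sub>v v) x = c * lform v x"
    using assms x by (simp add: lform_expand algebra_simps)
  with assms x show "neg_reflection (c \<cdot>\<^sub>v v) *\<^sub>v x = neg_reflection v *\<^sub>v x"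
    by (simp add: neg_reflection_mult_vec lform_smult smult_smult_assoc field_simps)
qed simp_all

lemma neg_reflection_involution:
  assumes "v \<in> carrier_vec 5" "lform v v \<noteq> 0"
  shows "neg_reflection v * neg_reflection v = 1\<^sub>m 5"
proof (rule mat_eq_if_mult_vec_eq)
  fix x :: "real vec" assume x: "x \<in> carrier_vec 5"
  define c where "c = 2 * lform v x / lform v v"
  have cv: "c \<cdot>\<^sub>v v - x \<in> carrier_vec 5" using assms x by simp
  have "2 * lform v (c \<cdot>\<^sub>v v - x) / lform v v = c"
    using assms x by (simp add: lform_lincomb c_def field_simps)
  then have "neg_reflection v *\<^sub>v (neg_reflection v *\<^sub>v x) = c \<cdot>\<^sub>v v - (c \<cdot>\<^sub>v v - x)"
    using assms x cv by (simp add: neg_reflection_mult_vec c_def[symmetric])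
  also have "\<dots> = x" using assms x by (intro eq_vec_5I) auto
  finally show "neg_reflection v * neg_reflection v *\<^sub>v x = 1\<^sub>m 5 *\<^sub>v x"
    using x by (simp add: assoc_mult_mat_vec[of _ 5 5 _ 5])
qed (auto intro: mult_carrier_mat[of _ 5 5])

text \<open>Rescaling to norm 1 or -1 does not change the reflections; the positive product of the
  norms makes the rescaled vectors of equal type, as \<open>spin41p\<close> demands.\<close>

lemma neg_reflection_pair_lift:
  assumes v: "v \<in> carrier_vec 5" and w: "w \<in> carrier_vec 5" and pos: "lform v v * lform w w > 0"
  shows "\<exists>g\<in>spin41p. eta g = neg_reflection v * neg_reflection w"
proof -
  define a b where "a = 1 / sqrt \<bar>lform v v\<bar>" and "b = 1 / sqrt \<bar>lform w w\<bar>"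
  have nz: "lform v v \<noteq> 0" "lform w w \<noteq> 0" using pos by auto
  then have ab: "a \<noteq> 0" "b \<noteq> 0" by (auto simp: a_def b_def)
  have "a * a = 1 / \<bar>lform v v\<bar>" "b * b = 1 / \<bar>lform w w\<bar>"
    by (simp_all add: a_def b_def)
  then have "lform (a \<cdot>\<^sub>v v) (a \<cdot>\<^sub>v v) = sgn (lform v v)" "lform (b \<cdot>\<^sub>v w) (b \<cdot>\<^sub>v w) = sgn (lform w w)"
    using v w by (simp_all add: lform_smult sgn_div_norm field_simps real_sgn_eq)
  moreover have "sgn (lform v v) = sgn (lform w w)"
    using pos by (auto simp: sgn_if zero_less_mult_iff)
  moreover have "sgn (lform v v) = 1 \<or> sgn (lform v v) = - 1" using nz by (auto simp: sgn_if)
  ultimately have "cliff (a \<cdot>\<^sub>v v) * cliff (b \<cdot>\<^sub>v w) \<in> spin41p"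
    "eta (cliff (a \<cdot>\<^sub>v v) * cliff (b \<cdot>\<^sub>v w)) = neg_reflection v * neg_reflection w"
    using v w ab by (auto simp: spin41p_pair eta_pair neg_reflection_smult)
  then show ?thesis by blast
qed

lemma lift_of_neg_reflection_pair_mult:
  assumes v: "v \<in> carrier_vec 5" and w: "w \<in> carrier_vec 5" and pos: "lform v v * lform w w > 0"
    and f: "f \<in> carrier_mat 5 5" and g: "g \<in> spin41p" "eta g = neg_reflection v * neg_reflection w * f"
  shows "\<exists>g\<in>spin41p. eta g = f"
proof -
  obtain h where h: "h \<in> spin41p" "eta h = neg_reflection w * neg_reflection v"
    using neg_reflection_pair_lift[OF w v] pos by (auto simp: mult.commute)
  have nz: "lform v v \<noteq> 0" "lform w w \<noteq> 0" using pos by auto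
  let ?W = "neg_reflection w" and ?V = "neg_reflection v"
  have "eta (h * g) = ?W * ?V * (?V * (?W * f))"
    using h g f by (simp add: eta_mult assoc_mult_mat[of _ 5 5 _ 5 _ 5] mult_carrier_mat[of _ 5 5])
  also have "\<dots> = ?W * (?W * f)"
    using f v nz by (intro mult_mat_cancel_middle[of _ 5]) (auto simp: neg_reflection_involution mult_carrier_mat[of _ 5 5])
  also have "\<dots> = ?W * ?W * f"
    using f by (simp add: assoc_mult_mat[of _ 5 5 _ 5 _ 5])
  also have "\<dots> = f"
    using f w nz by (simp add: neg_reflection_involution)
  finally show ?thesis using spin41p_mult h g by blast
qed

lemma lform_unit_vec:
  assumes "i < 5" "x \<in> carrier_vec 5"
  shows "lform x (unit_vec 5 i) = (if i = 0 then - x $ 0 else x $ i)"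
  using assms by (auto simp: less_5_cases lform_expand)

lemma neg_reflection_orthogonal:
  assumes "v \<in> carrier_vec 5" "x \<in> carrier_vec 5" "lform v x = 0"
  shows "neg_reflection v *\<^sub>v x = - x"
  using assms by (simp add: neg_reflection_mult_vec) (intro eq_vec_5I, auto)

lemma neg_reflection_minus:
  assumes "v \<in> carrier_vec 5" "x \<in> carrier_vec 5"
  shows "neg_reflection v *\<^sub>v (- x) = - (neg_reflection v *\<^sub>v x)"
proof -
  have "lform v (- x) = - lform v x" using assms by (simp add: lform_expand)
  then show ?thesis
    using assms by (simp add: neg_reflection_mult_vec) (intro eq_vec_5I, auto)
qed

text \<open>The progress measure of the Cartan-Dieudonne induction: each step multiplies by a pair
  of reflections and fixes one more basis vector.\<close>

definition fixes_units :: "nat \<Rightarrow> real mat \<Rightarrow> bool" where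
  "fixes_units k f \<longleftrightarrow> (\<forall>i<k. f *\<^sub>v unit_vec 5 i = unit_vec 5 i)"

text \<open>Each of the two maps sends a basis vector orthogonal to its axis to the negative, and in
  a pair the signs cancel; so nothing gained earlier is lost.\<close>

lemma neg_reflection_pair_fixes:
  assumes f: "proper_isometry f" "fixes_units k f" and k: "k < 5"
    and v: "v \<in> carrier_vec 5" and w: "w \<in> carrier_vec 5" and pos: "lform v v * lform w w > 0"
    and orth: "\<And>i. i < k \<Longrightarrow> lform v (unit_vec 5 i) = 0 \<and> lform w (unit_vec 5 i) = 0"
    and map: "neg_reflection v *\<^sub>v (neg_reflection w *\<^sub>v (f *\<^sub>v unit_vec 5 k)) = unit_vec 5 k"
  shows "proper_isometry (neg_reflection v * neg_reflection w * f)"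
    and "fixes_units (Suc k) (neg_reflection v * neg_reflection w * f)"
proof -
  show "proper_isometry (neg_reflection v * neg_reflection w * f)"
    using f v w pos by (intro proper_isometry_mult proper_isometry_neg_reflection) auto
  have fc: "f \<in> carrier_mat 5 5" using f by (simp add: proper_isometry_def)
  have app: "neg_reflection v * neg_reflection w * f *\<^sub>v x = neg_reflection v *\<^sub>v (neg_reflection w *\<^sub>v (f *\<^sub>v x))"
    if "x \<in> carrier_vec 5" for x
    using fc that by (simp add: assoc_mult_mat_vec[of _ 5 5 _ 5] mult_carrier_mat[of _ 5 5] mult_mat_vec_carrier[of _ 5 5])
  show "fixes_units (Suc k) (neg_reflection v * neg_reflection w * f)"
    unfolding fixes_units_def
  proof (intro allI impI)
    fix i assume "i < Suc k"
    then consider "i < k" | "i = k" by linarith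
    then show "neg_reflection v * neg_reflection w * f *\<^sub>v unit_vec 5 i = unit_vec 5 i"
    proof cases
      case 1
      with f(2) have "f *\<^sub>v unit_vec 5 i = unit_vec 5 i" by (simp add: fixes_units_def)
      with 1 orth[OF 1] v w show ?thesis
        by (simp add: app neg_reflection_orthogonal neg_reflection_minus)
    next
      case 2
      with map show ?thesis by (simp add: app)
    qed
  qed
qed

text \<open>For vectors of equal norm, minus the reflection in p + e sends p to e. The second map
  fixes e and only completes the pair.\<close>

lemma neg_reflection_pair_moves:
  assumes p: "p \<in> carrier_vec 5" and e: "e \<in> carrier_vec 5" and eq: "lform p p = lform e e"
    and nz: "lform e e \<noteq> 0" "lform (p + e) (p + e) \<noteq> 0"
  shows "neg_reflection e *\<^sub>v (neg_reflection (p + e) *\<^sub>v p) = e"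
proof -
  have "lform (p + e) (p + e) = 2 * lform (p + e) p"
    using p e eq by (simp add: lform_expand algebra_simps)
  with nz(2) have "2 * lform (p + e) p / lform (p + e) (p + e) = 1" by simp
  then have "neg_reflection (p + e) *\<^sub>v p = e"
    using p e by (subst neg_reflection_mult_vec) (auto intro!: eq_vec_5I)
  moreover have "neg_reflection e *\<^sub>v e = e"
    using e nz(1) by (subst neg_reflection_mult_vec) (auto intro!: eq_vec_5I)
  ultimately show ?thesis by simp
qed

lemma fixes_units_image:
  assumes f: "proper_isometry f" "fixes_units k f" and k: "k < 5"
  defines "p \<equiv> f *\<^sub>v unit_vec 5 k"
  shows "p \<in> carrier_vec 5" "lform p p = (if k = 0 then - 1 else 1)" "\<And>i. i < k \<Longrightarrow> p $ i = 0"
proof -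
  have fc: "f \<in> carrier_mat 5 5" using f by (simp add: proper_isometry_def)
  then show pc: "p \<in> carrier_vec 5" by (simp add: p_def mult_mat_vec_carrier[of _ 5 5])
  have "lform p p = lform (unit_vec 5 k) (unit_vec 5 k)" using f by (simp add: p_def proper_isometry_def)
  then show "lform p p = (if k = 0 then - 1 else 1)" using k by (simp add: lform_unit_vec)
  fix i assume i: "i < k"
  then have "lform p (unit_vec 5 i) = lform (f *\<^sub>v unit_vec 5 k) (f *\<^sub>v unit_vec 5 i)"
    using f by (simp add: p_def fixes_units_def)
  also have "\<dots> = lform (unit_vec 5 k) (unit_vec 5 i)"
    using f by (simp add: proper_isometry_def)
  also have "\<dots> = 0" using i k by (simp add: lform_unit_vec)
  finally show "p $ i = 0" using i k pc by (simp add: lform_unit_vec split: if_splits)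
qed

text \<open>All that remains open is the last column, a multiple c of the last basis vector with c^2
  = 1; the determinant is c, so c = 1.\<close>

lemma lift_fixes_4:
  assumes f: "proper_isometry f" "fixes_units 4 f"
  shows "\<exists>g\<in>spin41p. eta g = f"
proof -
  define p where "p = f *\<^sub>v unit_vec 5 4"
  have p: "p \<in> carrier_vec 5" "lform p p = 1" "\<And>i. i < 4 \<Longrightarrow> p $ i = 0"
    using fixes_units_image[OF f] by (auto simp: p_def)
  have fc: "f \<in> carrier_mat 5 5" using f by (simp add: proper_isometry_def)
  define c where "c = p $ 4"
  have cc: "c * c = 1" using p(2) p(3)[of 0] p(3)[of 1] p(3)[of 2] p(3)[of 3]
    by (simp add: lform_expand c_def)
  let ?x = "\<lambda>i::nat. if i = 4 then c - 1 else 0" and ?y = "\<lambda>j::nat. if j = 4 then 1 else 0 :: real"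
  have "f = mat 5 5 (\<lambda>(i, j). (if i = j then 1 else 0) + ?x i * ?y j)" (is "f = ?M")
  proof (rule eq_matI)
    fix i j assume "i < dim_row ?M" "j < dim_col ?M"
    then have ij: "i < 5" "j < 5" by auto
    then have col: "f $$ (i, j) = (f *\<^sub>v unit_vec 5 j) $ i" using fc by simp
    show "f $$ (i, j) = ?M $$ (i, j)"
    proof (cases "j = 4")
      case True
      with ij col have "f $$ (i, j) = p $ i" by (simp add: p_def)
      with True ij p(3)[of i] show ?thesis by (cases "i = 4") (auto simp: c_def)
    next
      case False
      with ij have "j < 4" by simp
      with f(2) have "f *\<^sub>v unit_vec 5 j = unit_vec 5 j" by (simp add: fixes_units_def)
      with False ij col show ?thesis by simp
    qed
  qed (use fc in auto)
  moreover from this have "det f = c"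
    by (subst \<open>f = ?M\<close>, subst det_one_plus_outer) (simp add: sum_less_5)
  then have "c = 1" using f by (simp add: proper_isometry_def)
  ultimately have "f = 1\<^sub>m 5" by (intro eq_matI) auto
  then show ?thesis using eta_one spin41p.one by blast
qed

text \<open>In the generic case the axes are p + e and e. Here (p + e, p + e) = 2 + 2 p_k, which is
  positive unless p_k = -1 because p is a unit vector without time component.\<close>

lemma lift_fixes_step:
  assumes f: "proper_isometry f" "fixes_units k f" and k: "0 < k" "k < 4"
    and IH: "\<And>f. proper_isometry f \<Longrightarrow> fixes_units (Suc k) f \<Longrightarrow> \<exists>g\<in>spin41p. eta g = f"
  shows "\<exists>g\<in>spin41p. eta g = f"
proof -
  have fc: "f \<in> carrier_mat 5 5" using f by (simp add: proper_isometry_def)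
  define p where "p = f *\<^sub>v unit_vec 5 k"
  have p: "p \<in> carrier_vec 5" "lform p p = 1" "\<And>i. i < k \<Longrightarrow> p $ i = 0"
    using fixes_units_image[OF f] k by (auto simp: p_def)
  define e :: "real vec" where "e = unit_vec 5 k"
  have fe: "f *\<^sub>v e = p" by (simp add: e_def p_def)
  have e: "e \<in> carrier_vec 5" "lform e e = 1" using k by (auto simp: e_def lform_unit_vec)
  have ei: "e $ i = (if i = k then 1 else 0)" if "i < 5" for i using that k by (simp add: e_def)
  have orth: "lform x (unit_vec 5 i) = 0" if "x \<in> carrier_vec 5" "x $ i = 0" "i < 5" for x i
    using that by (auto simp: lform_unit_vec)
  have squares: "(p $ 1)\<^sup>2 + (p $ 2)\<^sup>2 + (p $ 3)\<^sup>2 + (p $ 4)\<^sup>2 = 1"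
    using p(2) p(3)[of 0] k by (simp add: lform_expand power2_eq_square)
  show ?thesis
  proof (cases "p $ k = - 1")
    case False
    have "1 + p $ k > 0"
    proof -
      have "k = 1 \<or> k = 2 \<or> k = 3" using k by auto
      then have "(p $ k)\<^sup>2 \<le> 1"
        using squares zero_le_power2[of "p $ 1"] zero_le_power2[of "p $ 2"]
          zero_le_power2[of "p $ 3"] zero_le_power2[of "p $ 4"]
        by (elim disjE; hypsubst; linarith)
      then have "\<bar>p $ k\<bar> \<le> 1" by (simp add: abs_square_le_1)
      with False show ?thesis by linarith
    qed
    moreover have "lform (p + e) (p + e) = lform p p + lform e e + 2 * lform p e"
      using p e by (simp add: lform_expand algebra_simps)
    moreover have "lform p e = p $ k" using k p by (simp add: e_def lform_unit_vec)
    ultimately have pos: "lform (p + e) (p + e) > 0" using p e by simp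
    have "proper_isometry (neg_reflection e * neg_reflection (p + e) * f)"
      "fixes_units (Suc k) (neg_reflection e * neg_reflection (p + e) * f)"
      using f k p e ei pos neg_reflection_pair_moves[OF p(1) e(1)]
      by (auto intro!: neg_reflection_pair_fixes orth simp: e_def[symmetric] fe)
    then obtain g where "g \<in> spin41p" "eta g = neg_reflection e * neg_reflection (p + e) * f"
      using IH by blast
    then show ?thesis
      using lift_of_neg_reflection_pair_mult[of e "p + e" f g] p e pos fc by simp
  next
    case True
    \<comment> \<open>Now p = - e and p + e = 0 is no axis. The next basis vector is orthogonal to
      e, so minus its reflection turns - e into e; this needs room above \<open>k\<close>, whence k
      < 4.\<close>
    define d :: "real vec" where "d = unit_vec 5 (Suc k)"
    have d: "d \<in> carrier_vec 5" "lform d d = 1" using k by (auto simp: d_def lform_unit_vec)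
    have di: "d $ i = (if i = Suc k then 1 else 0)" if "i < 5" for i using that k by (simp add: d_def)
    have "p = - e"
    proof -
      from squares True p(3)[of 0] k p(1) e(1) show ?thesis
        by (intro eq_vec_5I) (auto simp: ei less_4_cases add_nonneg_eq_0_iff simp del: One_nat_def)
    qed
    moreover have "neg_reflection d *\<^sub>v e = - e"
      using d e k by (intro neg_reflection_orthogonal) (auto simp: e_def lform_unit_vec di)
    moreover have "neg_reflection e *\<^sub>v e = e"
      using e by (subst neg_reflection_mult_vec) (auto intro!: eq_vec_5I)
    ultimately have map: "neg_reflection e *\<^sub>v (neg_reflection d *\<^sub>v p) = e"
      using e d by (simp add: neg_reflection_minus)
    have "proper_isometry (neg_reflection e * neg_reflection d * f)"
      "fixes_units (Suc k) (neg_reflection e * neg_reflection d * f)"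
      using f k e d ei di map
      by (auto intro!: neg_reflection_pair_fixes orth simp: e_def[symmetric] fe)
    then obtain g where "g \<in> spin41p" "eta g = neg_reflection e * neg_reflection d * f"
      using IH by blast
    then show ?thesis
      using lift_of_neg_reflection_pair_mult[of e d f g] e d fc by simp
  qed
qed

lemma eta_surj:
  assumes "f \<in> SO41p"
  shows "\<exists>g\<in>spin41p. eta g = f"
proof -
  have f: "proper_isometry f" and f00: "f $$ (0, 0) > 0"
    using assms by (auto simp: SO41p_def proper_isometry_def)
  then have fc: "f \<in> carrier_mat 5 5" by (simp add: proper_isometry_def)
  have f0: "fixes_units 0 f" by (simp add: fixes_units_def)
  have 4: "\<exists>g\<in>spin41p. eta g = f" if "proper_isometry f" "fixes_units (Suc 3) f" for f
    using lift_fixes_4[of f] that by simp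
  have 3: "\<exists>g\<in>spin41p. eta g = f" if "proper_isometry f" "fixes_units (Suc 2) f" for f
    using lift_fixes_step[of f 3] that 4 by simp
  have 2: "\<exists>g\<in>spin41p. eta g = f" if "proper_isometry f" "fixes_units (Suc 1) f" for f
    using lift_fixes_step[of f 2] that 3 by (simp add: numeral_2_eq_2)
  have 1: "\<exists>g\<in>spin41p. eta g = f" if "proper_isometry f" "fixes_units (Suc 0) f" for f
    using lift_fixes_step[of f 1] that 2 by simp
  define p where "p = f *\<^sub>v unit_vec 5 0"
  define e :: "real vec" where "e = unit_vec 5 0"
  have p: "p \<in> carrier_vec 5" "lform p p = - 1"
    using fixes_units_image[OF f f0] by (auto simp: p_def)
  have e: "e \<in> carrier_vec 5" "lform e e = - 1" by (auto simp: e_def lform_unit_vec)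
  have fe: "f *\<^sub>v e = p" by (simp add: e_def p_def)
  \<comment> \<open>Staying on the upper sheet excludes the degenerate case p = - e: the norm of p +
    e is -2 - 2 p_0 < 0, so both axes are timelike.\<close>
  have "p $ 0 > 0" using f00 fc by (simp add: p_def)
  moreover have "lform (p + e) (p + e) = lform p p + lform e e + 2 * lform p e"
    using p e by (simp add: lform_expand algebra_simps)
  moreover have "lform p e = - p $ 0" using p by (simp add: e_def lform_unit_vec)
  ultimately have neg: "lform (p + e) (p + e) < 0" using p e by simp
  have "proper_isometry (neg_reflection e * neg_reflection (p + e) * f)"
    "fixes_units (Suc 0) (neg_reflection e * neg_reflection (p + e) * f)"
    using f f0 p e neg neg_reflection_pair_moves[OF p(1) e(1)]
    by (auto intro!: neg_reflection_pair_fixes simp: e_def[symmetric] fe)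
  then obtain g where "g \<in> spin41p" "eta g = neg_reflection e * neg_reflection (p + e) * f"
    using 1 by blast
  then show ?thesis
    using lift_of_neg_reflection_pair_mult[of e "p + e" f g] p e neg fc by simp
qed

section \<open>Reduction modulo the square root of 5\<close>

text \<open>The ring \<open>Z[1/2, sqrt 5, i]\<close>; its prime above 5 is generated by \<open>sqrt 5\<close>.\<close>
definition half_gauss_sqrt5 :: "complex set" where
  "half_gauss_sqrt5 = {z. \<exists>(k::nat) (a::int) (b::int) (c::int) (d::int).
     2 ^ k * z = Complex (a + b * sqrt 5) (c + d * sqrt 5)}"

lemma half_gauss_sqrt5I:
  "2 ^ k * z = Complex (real_of_int a + real_of_int b * sqrt 5) (real_of_int c + real_of_int d * sqrt 5) \<Longrightarrow> z \<in> half_gauss_sqrt5"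
  unfolding half_gauss_sqrt5_def by blast

lemma half_gauss_sqrt5_add:
  assumes "z \<in> half_gauss_sqrt5" "w \<in> half_gauss_sqrt5"
  shows "z + w \<in> half_gauss_sqrt5"
proof -
  obtain k a b c d where z: "2 ^ k * z = Complex (real_of_int a + real_of_int b * sqrt 5) (real_of_int c + real_of_int d * sqrt 5)"
    using assms(1) by (auto simp: half_gauss_sqrt5_def)
  obtain k' a' b' c' d' where w: "2 ^ k' * w = Complex (real_of_int a' + real_of_int b' * sqrt 5) (real_of_int c' + real_of_int d' * sqrt 5)"
    using assms(2) by (auto simp: half_gauss_sqrt5_def)
  have "2 ^ (k + k') * (z + w) = 2 ^ k' * (2 ^ k * z) + 2 ^ k * (2 ^ k' * w)"
    by (simp add: power_add algebra_simps)
  also have "\<dots> = Complex (real_of_int (2 ^ k' * a + 2 ^ k * a') + real_of_int (2 ^ k' * b + 2 ^ k * b') * sqrt 5)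
      (real_of_int (2 ^ k' * c + 2 ^ k * c') + real_of_int (2 ^ k' * d + 2 ^ k * d') * sqrt 5)"
  proof -
    have "2 ^ n * x = complex_of_real (2 ^ n) * x" for n and x :: complex by simp
    then have p: "Re (2 ^ n * x) = 2 ^ n * Re x" "Im (2 ^ n * x) = 2 ^ n * Im x" for n and x :: complex
      by (simp_all only: Re_complex_of_real Im_complex_of_real mult_zero_left times_complex.simps
          diff_zero add_0_right)
    show ?thesis unfolding z w by (simp add: complex_eq_iff p algebra_simps)
  qed
  finally show ?thesis by (rule half_gauss_sqrt5I)
qed

lemma half_gauss_sqrt5_mult:
  assumes "z \<in> half_gauss_sqrt5" "w \<in> half_gauss_sqrt5"
  shows "z * w \<in> half_gauss_sqrt5"
proof -
  obtain k a b c d where z: "2 ^ k * z = Complex (real_of_int a + real_of_int b * sqrt 5) (real_of_int c + real_of_int d * sqrt 5)"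
    using assms(1) by (auto simp: half_gauss_sqrt5_def)
  obtain k' a' b' c' d' where w: "2 ^ k' * w = Complex (real_of_int a' + real_of_int b' * sqrt 5) (real_of_int c' + real_of_int d' * sqrt 5)"
    using assms(2) by (auto simp: half_gauss_sqrt5_def)
  have "2 ^ (k + k') * (z * w) = (2 ^ k * z) * (2 ^ k' * w)"
    by (simp add: power_add algebra_simps)
  also have "\<dots> = Complex
      (real_of_int (a * a' + 5 * b * b' - c * c' - 5 * d * d') + real_of_int (a * b' + b * a' - c * d' - d * c') * sqrt 5)
      (real_of_int (a * c' + 5 * b * d' + c * a' + 5 * d * b') + real_of_int (a * d' + b * c' + c * b' + d * a') * sqrt 5)"
  proof -
    have s: "sqrt 5 * (sqrt 5 * x) = 5 * x" for x by (simp flip: mult.assoc)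
    show ?thesis unfolding z w by (simp add: complex_eq_iff s algebra_simps)
  qed
  finally show ?thesis by (rule half_gauss_sqrt5I)
qed

lemma half_gauss_sqrt5_basic:
  "of_int n \<in> half_gauss_sqrt5" "0 \<in> half_gauss_sqrt5" "1 \<in> half_gauss_sqrt5" "\<i> \<in> half_gauss_sqrt5"
  "1 / 2 \<in> half_gauss_sqrt5" "complex_of_real (sqrt 5) \<in> half_gauss_sqrt5"
  "complex_of_real phi \<in> half_gauss_sqrt5"
proof -
  show n: "of_int n \<in> half_gauss_sqrt5" for n
    by (rule half_gauss_sqrt5I[of 0 _ n 0 0 0]) (simp add: complex_eq_iff)
  from n[of 0] n[of 1] show "0 \<in> half_gauss_sqrt5" "1 \<in> half_gauss_sqrt5" by simp_all
  show "\<i> \<in> half_gauss_sqrt5"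
    by (rule half_gauss_sqrt5I[of 0 _ 0 0 1 0]) (simp add: complex_eq_iff)
  show "1 / 2 \<in> half_gauss_sqrt5"
    by (rule half_gauss_sqrt5I[of 1 _ 1 0 0 0]) (simp add: complex_eq_iff)
  show "complex_of_real (sqrt 5) \<in> half_gauss_sqrt5"
    by (rule half_gauss_sqrt5I[of 0 _ 0 1 0 0]) (simp add: complex_eq_iff)
  show "complex_of_real phi \<in> half_gauss_sqrt5"
    by (rule half_gauss_sqrt5I[of 1 _ 1 1 0 0]) (simp add: complex_eq_iff phi_def)
qed

lemma half_gauss_sqrt5_uminus: "z \<in> half_gauss_sqrt5 \<Longrightarrow> - z \<in> half_gauss_sqrt5"
  using half_gauss_sqrt5_mult[OF half_gauss_sqrt5_basic(1)[of "-1"]] by simp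

lemma half_gauss_sqrt5_diff:
  "z \<in> half_gauss_sqrt5 \<Longrightarrow> w \<in> half_gauss_sqrt5 \<Longrightarrow> z - w \<in> half_gauss_sqrt5"
  using half_gauss_sqrt5_add[of z "- w"] by (simp add: half_gauss_sqrt5_uminus)

lemma half_gauss_sqrt5_sum: "(\<And>i. i \<in> I \<Longrightarrow> f i \<in> half_gauss_sqrt5) \<Longrightarrow> sum f I \<in> half_gauss_sqrt5"
  by (induction I rule: infinite_finite_induct) (auto intro: half_gauss_sqrt5_basic half_gauss_sqrt5_add)

text \<open>Clearing denominators and taking real parts leaves sqrt 5 * a = 2^k * 8 - 5 b in
  integers. Squaring shows that 5 divides the right side, hence a power of 2.\<close>

lemma eight_not_in_sqrt5_ideal:
  assumes "z \<in> half_gauss_sqrt5"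
  shows "complex_of_real (sqrt 5) * z \<noteq> 8"
proof
  assume eq: "complex_of_real (sqrt 5) * z = 8"
  obtain k a b c d where z: "2 ^ k * z = Complex (real_of_int a + real_of_int b * sqrt 5) (real_of_int c + real_of_int d * sqrt 5)"
    using assms by (auto simp: half_gauss_sqrt5_def)
  have "complex_of_real (sqrt 5) * (2 ^ k * z) = complex_of_real (2 ^ k * 8)"
    using eq by (simp add: algebra_simps)
  then have "sqrt 5 * (real_of_int a + real_of_int b * sqrt 5) = 2 ^ k * 8"
    unfolding z by (simp add: complex_eq_iff)
  then have "sqrt 5 * real_of_int a = real_of_int (2 ^ k * 8 - 5 * b)"
    by (simp add: algebra_simps)
  then have "(sqrt 5 * real_of_int a)\<^sup>2 = (real_of_int (2 ^ k * 8 - 5 * b))\<^sup>2" by simp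
  then have "real_of_int (5 * a\<^sup>2) = real_of_int ((2 ^ k * 8 - 5 * b)\<^sup>2)"
    by (simp add: power_mult_distrib)
  then have "5 * a\<^sup>2 = (2 ^ k * 8 - 5 * b)\<^sup>2" by (simp only: of_int_eq_iff)
  moreover have p5: "prime (5::int)" by simp
  ultimately have "5 dvd 2 ^ k * 8 - 5 * b" by (metis dvd_triv_left prime_dvd_power)
  then have "5 dvd 2 ^ k * (8::int)" by (simp add: dvd_diff_left_iff)
  then have "5 dvd (2::int) ^ (k + 3)" by (simp add: power_add)
  with p5 have "(5::int) dvd 2" by (metis prime_dvd_power)
  then show False by simp
qed

text \<open>In the lifted generators each entry of an off-diagonal block carries the factor \<open>5^(1/4)\<close>.\<close>
definition block_weight :: "nat \<Rightarrow> nat \<Rightarrow> complex" where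
  "block_weight i j = complex_of_real (if i div 2 = j div 2 then sqrt 5 else sqrt (sqrt 5))"

text \<open>A two-sided ideal in the ring of matrices with diagonal blocks over the ring R and
  off-diagonal blocks over 5^(1/4) R. Working modulo it remembers only the diagonal blocks modulo
  \<open>sqrt 5\<close>.\<close>

definition congruence_ideal :: "complex mat set" where
  "congruence_ideal = {N \<in> carrier_mat 4 4.
     \<forall>i<4. \<forall>j<4. \<exists>z\<in>half_gauss_sqrt5. N $$ (i, j) = block_weight i j * z}"

text \<open>With only two blocks, two off-diagonal steps return to the same block, and their weights
  multiply to \<open>sqrt 5\<close>, exactly the weight required there. In the other cases a factor
  \<open>sqrt 5\<close> is left over.\<close>

lemma block_weight_mult:
  assumes "i < 4" "j < 4" "k < 4"
  shows "\<exists>z\<in>half_gauss_sqrt5. block_weight i k * block_weight k j = block_weight i j * z"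
proof -
  have s: "complex_of_real (sqrt (sqrt 5)) * complex_of_real (sqrt (sqrt 5)) = complex_of_real (sqrt 5)"
    by (simp flip: of_real_mult)
  have "i div 2 < 2" "j div 2 < 2" "k div 2 < 2" using assms by auto
  then show ?thesis
    using half_gauss_sqrt5_basic(3,6)
    by (auto simp: block_weight_def s intro!: bexI[of _ "complex_of_real (sqrt 5)"])
qed

lemma congruence_ideal_add:
  "N \<in> congruence_ideal \<Longrightarrow> M \<in> congruence_ideal \<Longrightarrow> N + M \<in> congruence_ideal"
proof -
  assume N: "N \<in> congruence_ideal" and M: "M \<in> congruence_ideal"
  have "\<exists>z\<in>half_gauss_sqrt5. (N + M) $$ (i, j) = block_weight i j * z" if ij: "i < 4" "j < 4" for i j
  proof -
    obtain z w where "z \<in> half_gauss_sqrt5" "N $$ (i, j) = block_weight i j * z"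
      "w \<in> half_gauss_sqrt5" "M $$ (i, j) = block_weight i j * w"
      using N M ij unfolding congruence_ideal_def by blast
    moreover have "(N + M) $$ (i, j) = N $$ (i, j) + M $$ (i, j)"
      using M ij by (auto simp: congruence_ideal_def)
    ultimately show ?thesis
      by (intro bexI[of _ "z + w"]) (simp_all add: half_gauss_sqrt5_add distrib_left)
  qed
  with N M show ?thesis by (simp add: congruence_ideal_def)
qed

lemma congruence_ideal_mult:
  assumes N: "N \<in> congruence_ideal" and M: "M \<in> congruence_ideal"
  shows "N * M \<in> congruence_ideal"
  unfolding congruence_ideal_def
proof (intro CollectI conjI allI impI)
  show "N * M \<in> carrier_mat 4 4"
    using assms by (auto simp: congruence_ideal_def)
  fix i j :: nat assume ij: "i < 4" "j < 4"
  have entry: "\<exists>z\<in>half_gauss_sqrt5. N $$ (i, k) * M $$ (k, j) = block_weight i j * z" if k: "k < 4" for k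
  proof -
    obtain z w where "z \<in> half_gauss_sqrt5" "N $$ (i, k) = block_weight i k * z"
      "w \<in> half_gauss_sqrt5" "M $$ (k, j) = block_weight k j * w"
      using N M ij k unfolding congruence_ideal_def by blast
    moreover obtain y where "y \<in> half_gauss_sqrt5" "block_weight i k * block_weight k j = block_weight i j * y"
      using block_weight_mult[OF ij k] by blast
    moreover have "block_weight i k * z * (block_weight k j * w)
        = (block_weight i k * block_weight k j) * (z * w)" by (simp only: mult_ac)
    ultimately show ?thesis
      by (intro bexI[of _ "y * (z * w)"]) (simp_all add: half_gauss_sqrt5_mult mult.assoc)
  qed
  from entry obtain z where z: "\<And>k. k < 4 \<Longrightarrow> z k \<in> half_gauss_sqrt5 \<and> N $$ (i, k) * M $$ (k, j) = block_weight i j * z k"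
    by metis
  have "(N * M) $$ (i, j) = block_weight i j * (z 0 + z 1 + z 2 + z 3)"
    using N M ij z[of 0] z[of 1] z[of 2] z[of 3]
    by (subst index_mult_mat_4) (auto simp: congruence_ideal_def algebra_simps)
  then show "\<exists>z\<in>half_gauss_sqrt5. (N * M) $$ (i, j) = block_weight i j * z"
    using z by (intro bexI[of _ "z 0 + z 1 + z 2 + z 3"] half_gauss_sqrt5_add) auto
qed

definition congruence_group :: "complex mat set" where
  "congruence_group = {g \<in> carrier_mat 4 4. g - 1\<^sub>m 4 \<in> congruence_ideal}"

lemma congruence_group_one: "1\<^sub>m 4 \<in> congruence_group"
  by (auto simp: congruence_group_def congruence_ideal_def intro!: bexI[OF _ half_gauss_sqrt5_basic(2)])

lemma congruence_group_mult:
  assumes g: "g \<in> congruence_group" and h: "h \<in> congruence_group"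
  shows "g * h \<in> congruence_group"
proof -
  have carr: "g \<in> carrier_mat 4 4" "h \<in> carrier_mat 4 4"
    using assms by (auto simp: congruence_group_def)
  have [simp]: "dim_row g = 4" "dim_col g = 4" "dim_row h = 4" "dim_col h = 4"
    using carr by auto
  note [simp] = carr
  let ?N = "g - 1\<^sub>m 4" and ?M = "h - 1\<^sub>m 4"
  have "?N * ?M = g * h - h - (g - 1\<^sub>m 4)"
    by (simp add: minus_mult_distrib_mat[of _ 4 4 _ _ 4] mult_minus_distrib_mat[of _ 4 4 _ 4]
        right_mult_one_mat[of _ 4 4] left_mult_one_mat[of _ 4 4] minus_carrier_mat)
  then have "g * h - 1\<^sub>m 4 = ?N + ?M + ?N * ?M"
    by (intro eq_mat_4I) (auto simp: mult_carrier_mat[of _ 4 4] minus_carrier_mat simp del: index_mult_mat(1))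
  then show ?thesis
    using g h by (auto simp: congruence_group_def mult_carrier_mat[of _ 4 4] intro!: congruence_ideal_add congruence_ideal_mult)
qed

section \<open>Traces modulo the square root of 5\<close>

definition mat_trace_4 :: "complex mat \<Rightarrow> complex" where
  "mat_trace_4 g = (\<Sum>i<4. g $$ (i, i))"

lemma mat_trace_4_commute:
  assumes "g \<in> carrier_mat 4 4" "h \<in> carrier_mat 4 4"
  shows "mat_trace_4 (g * h) = mat_trace_4 (h * g)"
proof -
  have "mat_trace_4 (g * h) = (\<Sum>i<4. \<Sum>k<4. g $$ (i, k) * h $$ (k, i))" if "g \<in> carrier_mat 4 4" "h \<in> carrier_mat 4 4" for g h
    using that by (simp add: mat_trace_4_def scalar_prod_def atLeast0LessThan)
  from this[OF assms] this[OF assms(2,1)] show ?thesis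
    using sum.swap[of "\<lambda>i k. g $$ (i, k) * h $$ (k, i)" "{..<4}" "{..<4}"] by (simp add: mult.commute)
qed

lemma congruence_group_trace:
  assumes "g \<in> congruence_group"
  shows "\<exists>z\<in>half_gauss_sqrt5. mat_trace_4 g = 4 + complex_of_real (sqrt 5) * z"
proof -
  have gc: "g \<in> carrier_mat 4 4" using assms by (simp add: congruence_group_def)
  have "\<exists>z\<in>half_gauss_sqrt5. g $$ (i, i) = 1 + complex_of_real (sqrt 5) * z" if i: "i < 4" for i
  proof -
    obtain z where "z \<in> half_gauss_sqrt5" "(g - 1\<^sub>m 4) $$ (i, i) = block_weight i i * z"
      using assms i unfolding congruence_group_def congruence_ideal_def by blast
    with i gc show ?thesis by (auto simp: block_weight_def algebra_simps intro!: bexI[of _ z])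
  qed
  then obtain z where z: "\<And>i. i < 4 \<Longrightarrow> z i \<in> half_gauss_sqrt5 \<and> g $$ (i, i) = 1 + complex_of_real (sqrt 5) * z i"
    by metis
  then have "mat_trace_4 g = (\<Sum>i<4. 1 + complex_of_real (sqrt 5) * z i)"
    by (simp add: mat_trace_4_def)
  also have "\<dots> = 4 + complex_of_real (sqrt 5) * (\<Sum>i<4. z i)"
    by (simp add: sum.distrib sum_distrib_left)
  finally show ?thesis using z by (auto intro!: bexI[of _ "\<Sum>i<4. z i"] half_gauss_sqrt5_sum)
qed

text \<open>The two traces would add up to 0, while their sum is 8 modulo \<open>sqrt 5\<close>. Two
  different elements are allowed because a conjugate of one has to be told apart from the negative
  of another.\<close>

lemma congruence_group_trace_neq_uminus:
  assumes "g \<in> congruence_group" "h \<in> congruence_group"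
  shows "mat_trace_4 g \<noteq> - mat_trace_4 h"
proof
  assume eq: "mat_trace_4 g = - mat_trace_4 h"
  obtain z where z: "z \<in> half_gauss_sqrt5" "mat_trace_4 g = 4 + complex_of_real (sqrt 5) * z"
    using congruence_group_trace[OF assms(1)] by blast
  obtain w where w: "w \<in> half_gauss_sqrt5" "mat_trace_4 h = 4 + complex_of_real (sqrt 5) * w"
    using congruence_group_trace[OF assms(2)] by blast
  have "mat_trace_4 g + mat_trace_4 h = 0" by (simp add: eq)
  then have "complex_of_real (sqrt 5) * (z + w) + 8 = 0"
    unfolding z(2) w(2) by (simp add: algebra_simps)
  then have "complex_of_real (sqrt 5) * (- (z + w)) = 8"
    by (simp only: mult_minus_right minus_unique)
  then show False
    using z(1) w(1) eight_not_in_sqrt5_ideal half_gauss_sqrt5_uminus half_gauss_sqrt5_add by blast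
qed

lemma mat_trace_4_uminus: "g \<in> carrier_mat 4 4 \<Longrightarrow> mat_trace_4 (- g) = - mat_trace_4 g"
  by (simp add: mat_trace_4_def sum_negf)

section \<open>The 600-cell over the golden integers\<close>

lemma phi_square: "phi * phi = phi + 1"
  by (simp add: phi_def field_simps)

lemma phi_pos: "phi > 0"
  by (simp add: phi_def add_pos_pos)

lemma sqrt_5_eq: "sqrt 5 = 2 * phi - 1"
  by (simp add: phi_def field_simps)

lemma inverse_phi: "1 / phi = phi - 1"
  using phi_square phi_pos by (simp add: field_simps)

text \<open>A vector of \<open>Z[phi]\<close>-coordinates is stored as the list of its doubled coordinates
  \<open>a + b * phi\<close>, each given as the pair \<open>(a, b)\<close>.\<close>
type_synonym golden = "int \<times> int"

definition golden_real :: "golden \<Rightarrow> real" where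
  "golden_real x = of_int (fst x) + of_int (snd x) * phi"

definition golden_mult :: "golden \<Rightarrow> golden \<Rightarrow> golden" where
  "golden_mult x y = (fst x * fst y + snd x * snd y, fst x * snd y + snd x * fst y + snd x * snd y)"

definition golden_vec :: "golden list \<Rightarrow> real vec" where
  "golden_vec X = emb4 (\<lambda>k. golden_real (X ! k) / 2)"

definition golden_dot :: "golden list \<Rightarrow> golden list \<Rightarrow> golden" where
  "golden_dot X Y = (let zs = map2 golden_mult X Y in (sum_list (map fst zs), sum_list (map snd zs)))"

text \<open>On doubled coordinates \<open>golden_dot\<close> is four times the inner product, so for
  a unit vector \<open>V\<close> the coefficient 2 (v, x) is \<open>d\<close> / 2. The integer
  division is exact where both components of \<open>d\<close> are even.\<close>

definition golden_neg_reflection :: "golden list \<Rightarrow> golden list \<Rightarrow> golden list" where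
  "golden_neg_reflection V X = (let d = golden_dot V X; h = (fst d div 2, snd d div 2)
     in map2 (\<lambda>v x. (fst (golden_mult h v) - fst x, snd (golden_mult h v) - snd x)) V X)"

definition even_perms_4 :: "nat list list" where
  "even_perms_4 = [[0,1,2,3], [2,0,1,3], [1,2,0,3], [1,0,3,2], [0,3,1,2], [3,1,0,2],
     [3,0,2,1], [0,2,3,1], [2,3,0,1], [1,3,2,0], [3,2,1,0], [2,1,3,0]]"

text \<open>The 17 coordinate patterns up to sign: 4 axes, 1 half-integral one and 12 golden ones,
  where (-1, 1) stands for phi - 1 = 1 / phi. As \<open>icosians\<close> puts no sign on a zero,
  they give 8 + 16 + 96 = 120 vectors.\<close>

definition icosian_shapes :: "golden list list" where
  "icosian_shapes = [[(2,0),(0,0),(0,0),(0,0)], [(0,0),(2,0),(0,0),(0,0)], [(0,0),(0,0),(2,0),(0,0)],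
     [(0,0),(0,0),(0,0),(2,0)], [(1,0),(1,0),(1,0),(1,0)]]
     @ map (map (nth [(0, 1), (1, 0), (-1, 1), (0, 0)])) even_perms_4"

definition golden_uminus :: "golden \<Rightarrow> golden" where
  "golden_uminus x = (- fst x, - snd x)"

definition icosians :: "golden list list" where
  "icosians = concat (map (\<lambda>t. product_lists
     (map (\<lambda>x. if x = (0, 0) then [x] else [x, golden_uminus x]) t)) icosian_shapes)"

text \<open>Compares with 17 patterns up to sign in place of 120 vectors, which keeps the finite
  checks small.\<close>

definition is_icosian :: "golden list \<Rightarrow> bool" where
  "is_icosian X \<longleftrightarrow> list_ex (list_all2 (\<lambda>x y. x = y \<or> x = golden_uminus y) X) icosian_shapes"

text \<open>What counts is that even words in these four reflections reach all 120 directions from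
  the first root. The mutual inner products are 0, 1/2 and phi/2, so this is not the usual obtuse
  simple system.\<close>

definition simple_roots :: "golden list list" where
  "simple_roots = [[(2,0),(0,0),(0,0),(0,0)], [(0,0),(0,0),(0,0),(2,0)], [(1,0),(1,0),(1,0),(1,0)], [(0,1),(1,0),(-1,1),(0,0)]]"

section \<open>Even permutations and the coordinate patterns\<close>

lemma less_4_set: "{0..<4::nat} = insert 3 (insert 2 (insert 1 (insert 0 {})))"
  by auto

text \<open>Every permutation of four points is a product (3 b)(2 c)(1 d) with b, c, d not above 3,
  2, 1. Its parity is read off from which factors are trivial, so the set can be enumerated.\<close>

lemma set_even_perms_4:
  "set even_perms_4 = {[p 0, p 1, p 2, p 3] | p. p permutes {0..<4::nat} \<and> evenperm p}"
proof -
  have step: "p permutes insert a S \<longleftrightarrow> (\<exists>b\<in>insert a S. \<exists>q. q permutes S \<and> p = transpose a b \<circ> q)"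
    for p :: "nat \<Rightarrow> nat" and a S
    using permutes_insert[of a S] by (auto simp: set_eq_iff image_iff)
  define T :: "nat \<Rightarrow> nat \<Rightarrow> nat \<Rightarrow> nat \<Rightarrow> nat"
    where "T b c d = transpose 3 b \<circ> (transpose 2 c \<circ> transpose 1 d)" for b c d
  have 1: "p permutes insert 1 (insert 0 {}) \<longleftrightarrow> (\<exists>d\<in>{1, 0}. p = transpose 1 d)" for p :: "nat \<Rightarrow> nat"
    unfolding step[of p 1] permutes_sing by simp
  have 2: "p permutes insert 2 (insert 1 (insert 0 {}))
      \<longleftrightarrow> (\<exists>c\<in>{2, 1, 0}. \<exists>d\<in>{1, 0}. p = transpose 2 c \<circ> transpose 1 d)" for p :: "nat \<Rightarrow> nat"
    unfolding step[of p 2] 1 by blast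
  have 3: "p permutes {0..<4} \<longleftrightarrow> (\<exists>b\<in>{3, 2, 1, 0}. \<exists>c\<in>{2, 1, 0}. \<exists>d\<in>{1, 0}. p = T b c d)" for p
    unfolding less_4_set step[of p 3] 2 T_def by blast
  have ev: "evenperm (T b c d) \<longleftrightarrow> ((3 = b) = ((2 = c) = (1 = d)))" for b c d
    unfolding T_def
    by (simp only: evenperm_comp evenperm_swap permutation_swap_id permutation_compose)
  have pull: "(\<exists>p. q = f p \<and> (\<exists>b\<in>B. \<exists>c\<in>C. \<exists>d\<in>D. p = T b c d) \<and> E p)
      \<longleftrightarrow> (\<exists>b\<in>B. \<exists>c\<in>C. \<exists>d\<in>D. E (T b c d) \<and> q = f (T b c d))"
    for q :: "nat list" and f B C D E
    by blast
  show ?thesis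
    unfolding 3 pull ev by (simp add: even_perms_4_def T_def transpose_def set_eq_iff)
qed

lemma icosian_shapes_unfold:
  "icosian_shapes = [[(2,0),(0,0),(0,0),(0,0)], [(0,0),(2,0),(0,0),(0,0)], [(0,0),(0,0),(2,0),(0,0)],
     [(0,0),(0,0),(0,0),(2,0)], [(1,0),(1,0),(1,0),(1,0)],
     [(0,1),(1,0),(-1,1),(0,0)], [(-1,1),(0,1),(1,0),(0,0)], [(1,0),(-1,1),(0,1),(0,0)],
     [(1,0),(0,1),(0,0),(-1,1)], [(0,1),(0,0),(1,0),(-1,1)], [(0,0),(1,0),(0,1),(-1,1)],
     [(0,0),(0,1),(-1,1),(1,0)], [(0,1),(-1,1),(0,0),(1,0)], [(-1,1),(0,0),(0,1),(1,0)],
     [(1,0),(0,0),(-1,1),(0,1)], [(0,0),(-1,1),(1,0),(0,1)], [(-1,1),(1,0),(0,0),(0,1)]]"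
  by (simp add: icosian_shapes_def even_perms_4_def)

lemma in_set_icosians: "X \<in> set icosians \<longleftrightarrow> is_icosian X"
proof -
  have "x \<in> set (if y = (0, 0) then [y] else [y, golden_uminus y]) \<longleftrightarrow> x = y \<or> x = golden_uminus y"
    for x y by (auto simp: golden_uminus_def)
  then show ?thesis
    by (simp only: icosians_def is_icosian_def set_concat set_map image_image product_lists_set
        list_all2_map2 UN_iff mem_Collect_eq list_ex_iff)
qed

section \<open>Arithmetic in doubled golden coordinates\<close>

lemma golden_real_mult: "golden_real (golden_mult x y) = golden_real x * golden_real y"
proof -
  have "phi * (phi * z) = phi * z + z" for z
    using phi_square by (metis distrib_right mult.assoc mult_1)
  note phi = this phi_square
  show ?thesis by (simp add: golden_real_def golden_mult_def algebra_simps phi)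
qed

lemma golden_real_uminus: "golden_real (golden_uminus x) = - golden_real x"
  by (simp add: golden_real_def golden_uminus_def)

lemma golden_vec_carrier [simp]: "golden_vec X \<in> carrier_vec 5"
  by (simp add: golden_vec_def emb4_def)

lemma golden_vec_dim [simp]: "dim_vec (golden_vec X) = 5"
  by (simp add: golden_vec_def emb4_def)

lemma golden_vec_index:
  "golden_vec X $ 0 = 0" "golden_vec X $ 1 = golden_real (X ! 0) / 2" "golden_vec X $ 2 = golden_real (X ! 1) / 2"
  "golden_vec X $ 3 = golden_real (X ! 2) / 2" "golden_vec X $ 4 = golden_real (X ! 3) / 2"
  by (simp_all add: golden_vec_def emb4_def)

lemma length_4E:
  assumes "length X = 4"
  obtains a b c d where "X = [a, b, c, d]"
  using assms by (auto simp: length_Suc_conv eval_nat_numeral)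

lemma lform_golden_vec:
  assumes "length X = 4" "length Y = 4"
  shows "lform (golden_vec X) (golden_vec Y) = golden_real (golden_dot X Y) / 4"
proof -
  obtain a b c d where X: "X = [a, b, c, d]" using assms(1) by (rule length_4E)
  obtain a' b' c' d' where Y: "Y = [a', b', c', d']" using assms(2) by (rule length_4E)
  have "golden_real (golden_dot X Y) = golden_real (golden_mult a a') + golden_real (golden_mult b b')
      + golden_real (golden_mult c c') + golden_real (golden_mult d d')"
    by (simp add: X Y golden_dot_def golden_real_def algebra_simps)
  then show ?thesis
    unfolding golden_real_mult lform_expand golden_vec_index X Y
    by (simp add: eval_nat_numeral)
qed

lemma neg_reflection_golden_vec:
  assumes len: "length V = 4" "length X = 4" and V: "golden_dot V V = (4, 0)"
    and even: "even (fst (golden_dot V X))" "even (snd (golden_dot V X))"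
  shows "neg_reflection (golden_vec V) *\<^sub>v golden_vec X = golden_vec (golden_neg_reflection V X)"
proof -
  define d where "d = golden_dot V X"
  define h where "h = (fst d div 2, snd d div 2)"
  have "lform (golden_vec V) (golden_vec V) = 1"
    using V len by (simp add: lform_golden_vec golden_real_def)
  moreover have "golden_real d = 2 * golden_real h"
  proof -
    have "fst d = 2 * fst h" "snd d = 2 * snd h" using even by (auto simp: d_def h_def)
    then show ?thesis by (simp add: golden_real_def)
  qed
  ultimately have coeff: "2 * lform (golden_vec V) (golden_vec X) / lform (golden_vec V) (golden_vec V) = golden_real h"
    using len by (simp add: lform_golden_vec d_def[symmetric])
  have sub: "golden_real (fst (golden_mult h v) - fst x, snd (golden_mult h v) - snd x)
      = golden_real h * golden_real v - golden_real x" for v x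
    unfolding golden_real_mult[symmetric] by (simp add: golden_real_def algebra_simps)
  obtain v0 v1 v2 v3 where v: "V = [v0, v1, v2, v3]" using len(1) by (rule length_4E)
  obtain x0 x1 x2 x3 where x: "X = [x0, x1, x2, x3]" using len(2) by (rule length_4E)
  let ?f = "\<lambda>v x. (fst (golden_mult h v) - fst x, snd (golden_mult h v) - snd x)"
  have refl: "golden_neg_reflection V X = [?f v0 x0, ?f v1 x1, ?f v2 x2, ?f v3 x3]"
    unfolding golden_neg_reflection_def Let_def d_def[symmetric] h_def[symmetric]
    by (simp add: v x)
  show ?thesis
    unfolding refl
    using coeff
    by (simp add: neg_reflection_mult_vec)
      (intro eq_vec_5I, auto simp: golden_vec_index v x sub diff_divide_distrib simp del: One_nat_def)
qed

lemma emb4_cong: "(\<And>k. k < 4 \<Longrightarrow> f k = g k) \<Longrightarrow> emb4 f = emb4 g"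
  by (rule eq_vecI) (auto simp: emb4_def)

lemma length_icosian_shapes: "t \<in> set icosian_shapes \<Longrightarrow> length t = 4"
  by (auto simp: icosian_shapes_unfold)

text \<open>Signs become functions, as in \<open>cell120_dirs\<close>. A zero coordinate is its own
  negative, so the value of the sign function there is free.\<close>

lemma golden_vec_icosians:
  "golden_vec ` set icosians = {emb4 (\<lambda>k. s k * golden_real (t ! k) / 2) | s t.
     t \<in> set icosian_shapes \<and> (\<forall>k<4. s k = 1 \<or> s k = - 1)}" (is "_ = ?R")
proof (intro equalityI subsetI)
  fix u assume "u \<in> golden_vec ` set icosians"
  then obtain X t where u: "u = golden_vec X" and t: "t \<in> set icosian_shapes"
    "list_all2 (\<lambda>x y. x = y \<or> x = golden_uminus y) X t"
    by (auto simp: in_set_icosians is_icosian_def list_ex_iff)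
  define s :: "nat \<Rightarrow> real" where "s k = (if X ! k = t ! k then 1 else - 1)" for k
  have "u = emb4 (\<lambda>k. s k * golden_real (t ! k) / 2)"
    unfolding u golden_vec_def
  proof (rule emb4_cong)
    fix k :: nat assume "k < 4"
    then have "X ! k = t ! k \<or> X ! k = golden_uminus (t ! k)"
      using list_all2_nthD2[OF t(2), of k] length_icosian_shapes[OF t(1)] by simp
    then show "golden_real (X ! k) / 2 = s k * golden_real (t ! k) / 2"
      by (auto simp: s_def golden_real_uminus)
  qed
  moreover have "\<forall>k<4. s k = 1 \<or> s k = - 1" by (simp add: s_def)
  ultimately show "u \<in> ?R" using t by blast
next
  fix u assume "u \<in> ?R"
  then obtain s t where u: "u = emb4 (\<lambda>k. s k * golden_real (t ! k) / 2)"
    and t: "t \<in> set icosian_shapes" and s: "\<forall>k<4. s k = 1 \<or> s k = - 1" by blast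
  define X where "X = map (\<lambda>k. if s k = 1 then t ! k else golden_uminus (t ! k)) [0..<4]"
  have "list_all2 (\<lambda>x y. x = y \<or> x = golden_uminus y) X t"
    using length_icosian_shapes[OF t] by (auto simp: list_all2_conv_all_nth X_def)
  with t have "X \<in> set icosians" by (auto simp: in_set_icosians is_icosian_def list_ex_iff)
  moreover have "u = golden_vec X"
    unfolding u golden_vec_def using s by (intro emb4_cong) (auto simp: X_def golden_real_uminus)
  ultimately show "u \<in> golden_vec ` set icosians" by blast
qed

lemma replicate_4: "replicate 4 x = [x, x, x, x]"
  by (simp add: eval_nat_numeral)

lemma cell120_dirs_eq: "cell120_dirs = golden_vec ` set icosians"
proof (intro equalityI subsetI)
  note R = golden_vec_icosians
  fix u assume "u \<in> cell120_dirs"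
  then consider (axis) j s where "u = emb4 (\<lambda>k. if k = j then s else 0)" "j < 4" "s = 1 \<or> s = - 1"
    | (half) s where "u = emb4 (\<lambda>k. s k / 2)" "\<forall>k<4. s k = 1 \<or> s k = - 1"
    | (golden) s p where "u = emb4 (\<lambda>k. s k * ([phi, 1, 1 / phi, 0] ! p k) / 2)"
        "\<forall>k<4. s k = 1 \<or> s k = - 1" "p permutes {0..<4}" "evenperm p"
    unfolding cell120_dirs_def by blast
  then show "u \<in> golden_vec ` set icosians"
  proof cases
    case axis
    let ?t = "(replicate 4 (0, 0))[j := (2, 0)] :: golden list"
    have "?t \<in> set icosian_shapes"
      using axis(2) unfolding less_4_cases replicate_4
      by (elim disjE) (simp_all add: icosian_shapes_unfold list_update_code numeral_2_eq_2 numeral_3_eq_3)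
    moreover have "u = emb4 (\<lambda>k. s * golden_real (?t ! k) / 2)"
      unfolding axis(1) by (intro emb4_cong) (auto simp: nth_list_update golden_real_def)
    ultimately show ?thesis using axis(3) unfolding R by (intro CollectI exI[of _ "\<lambda>_. s"] exI[of _ ?t]) auto
  next
    case half
    let ?t = "[(1, 0), (1, 0), (1, 0), (1, 0)] :: golden list"
    have "?t \<in> set icosian_shapes" by (simp add: icosian_shapes_unfold)
    moreover have "u = emb4 (\<lambda>k. s k * golden_real (?t ! k) / 2)"
      unfolding half(1) by (intro emb4_cong) (auto simp: less_4_cases golden_real_def)
    ultimately show ?thesis using half(2) unfolding R by (intro CollectI exI[of _ s] exI[of _ ?t]) auto
  next
    case golden
    let ?v = "[(0, 1), (1, 0), (-1, 1), (0, 0)] :: golden list"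
    let ?t = "map (nth ?v) [p 0, p 1, p 2, p 3]"
    have "[p 0, p 1, p 2, p 3] \<in> set even_perms_4" using golden(3,4) unfolding set_even_perms_4 by blast
    then have "?t \<in> set icosian_shapes" unfolding icosian_shapes_def by (simp only: set_append set_map) blast
    moreover have "u = emb4 (\<lambda>k. s k * golden_real (?t ! k) / 2)"
      unfolding golden(1)
    proof (rule emb4_cong)
      fix k :: nat assume k: "k < 4"
      then have "p k < 4" using permutes_in_image[OF golden(3), of k] by simp
      then have "golden_real (?v ! p k) = [phi, 1, 1 / phi, 0] ! p k"
        unfolding less_4_cases by (elim disjE) (simp_all add: golden_real_def inverse_phi)
      moreover have "?t ! k = ?v ! p k" using k unfolding less_4_cases by (elim disjE) simp_all
      ultimately show "s k * ([phi, 1, 1 / phi, 0] ! p k) / 2 = s k * golden_real (?t ! k) / 2" by simp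
    qed
    ultimately show ?thesis using golden(2) unfolding R by (intro CollectI exI[of _ s] exI[of _ ?t]) auto
  qed
next
  fix u assume "u \<in> golden_vec ` set icosians"
  then obtain s t where u: "u = emb4 (\<lambda>k. s k * golden_real (t ! k) / 2)"
    and t: "t \<in> set icosian_shapes" and s: "\<forall>k<4. s k = 1 \<or> s k = - 1"
    unfolding golden_vec_icosians by blast
  let ?v = "[(0, 1), (1, 0), (-1, 1), (0, 0)] :: golden list"
  from t consider (axis) j where "j < 4" "t = (replicate 4 (0, 0))[j := (2, 0)]"
    | (half) "t = replicate 4 (1, 0)"
    | (golden) p where "p permutes {0..<4}" "evenperm p" "t = map (nth ?v) [p 0, p 1, p 2, p 3]"
  proof -
    assume cases: "\<And>j. j < 4 \<Longrightarrow> t = (replicate 4 (0, 0))[j := (2, 0)] \<Longrightarrow> thesis"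
      "t = replicate 4 (1, 0) \<Longrightarrow> thesis"
      "\<And>p. p permutes {0..<4} \<Longrightarrow> evenperm p \<Longrightarrow> t = map (nth ?v) [p 0, p 1, p 2, p 3] \<Longrightarrow> thesis"
    have "(\<exists>j\<in>{0, 1, 2, 3}. t = (replicate 4 (0, 0))[j := (2, 0)]) \<or> t = replicate 4 (1, 0)
        \<or> t \<in> (\<lambda>q. map (nth ?v) q) ` set even_perms_4"
      using t by (auto simp: icosian_shapes_def eval_nat_numeral)
    then show thesis
    proof (elim disjE)
      assume "t \<in> (\<lambda>q. map (nth ?v) q) ` set even_perms_4"
      then show thesis using cases(3) unfolding set_even_perms_4 by blast
    next
      assume "\<exists>j\<in>{0, 1, 2, 3}. t = (replicate 4 (0, 0))[j := (2, 0)]"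
      then obtain j where "j \<in> {0, 1, 2, 3}" "t = (replicate 4 (0, 0))[j := (2, 0)]" by blast
      then show thesis by (intro cases(1)[of j]) auto
    qed (use cases(2) in auto)
  qed
  then show "u \<in> cell120_dirs"
  proof cases
    case axis
    have "u = emb4 (\<lambda>k. if k = j then s j else 0)"
      unfolding u axis by (intro emb4_cong) (auto simp: nth_list_update golden_real_def)
    then show ?thesis using axis(1) s unfolding cell120_dirs_def by blast
  next
    case half
    have "u = emb4 (\<lambda>k. s k / 2)"
      unfolding u half by (intro emb4_cong) (auto simp: golden_real_def)
    then show ?thesis using s unfolding cell120_dirs_def by blast
  next
    case golden
    have "u = emb4 (\<lambda>k. s k * ([phi, 1, 1 / phi, 0] ! p k) / 2)"
      unfolding u golden(3)
    proof (rule emb4_cong)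
      fix k :: nat assume k: "k < 4"
      then have "p k < 4" using permutes_in_image[OF golden(1), of k] by simp
      then have "golden_real (?v ! p k) = [phi, 1, 1 / phi, 0] ! p k"
        unfolding less_4_cases by (elim disjE) (simp_all add: golden_real_def inverse_phi)
      moreover have "map (nth ?v) [p 0, p 1, p 2, p 3] ! k = ?v ! p k"
        using k unfolding less_4_cases by (elim disjE) simp_all
      ultimately show "s k * golden_real (map (nth ?v) [p 0, p 1, p 2, p 3] ! k) / 2
          = s k * ([phi, 1, 1 / phi, 0] ! p k) / 2" by simp
    qed
    then show ?thesis using golden(1,2) s unfolding cell120_dirs_def by blast
  qed
qed

section \<open>Transitivity of the rotation group of the 600-cell\<close>

primrec iterates :: "nat \<Rightarrow> ('a \<Rightarrow> 'a) \<Rightarrow> 'a \<Rightarrow> 'a list" where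
  "iterates 0 f x = []"
| "iterates (Suc n) f x = x # iterates n f (f x)"

lemma iterates_invariant:
  assumes "Q x" "\<And>y. Q y \<Longrightarrow> Q (f y)" "z \<in> set (iterates n f x)"
  shows "Q z"
  using assms(1,3) by (induction n arbitrary: x) (auto intro: assms(2))

text \<open>The first word of reflections is a Coxeter element of \<open>H4\<close>, of order 30; its four orbits
  on the roots are represented by iterates of the second word.\<close>
definition icosian_orbit :: "golden list list" where
  "icosian_orbit = (let e = [(2,0),(0,0),(0,0),(0,0)]; e' = [(0,0),(0,0),(0,0),(2,0)];
       a = [(1,0),(1,0),(1,0),(1,0)]; b = [(0,1),(1,0),(-1,1),(0,0)]
     in concat (map (iterates 30 (fold golden_neg_reflection [e, e', b, a]))
       (iterates 4 (fold golden_neg_reflection [b, e, b, a]) e)))"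

lemma icosians_check: "list_all (\<lambda>X. length X = 4 \<and> golden_dot X X = (4, 0)) icosians"
  by code_simp

text \<open>The 120 vectors are stable under the four reflections, and evenness makes the halving in
  \<open>golden_neg_reflection\<close> exact.\<close>

lemma icosians_reflection_check:
  "list_all (\<lambda>V. list_all (\<lambda>X. even (fst (golden_dot V X)) \<and> even (snd (golden_dot V X))
     \<and> is_icosian (golden_neg_reflection V X)) icosians) simple_roots"
  by code_simp

lemma icosian_orbit_check: "list_all is_icosian icosian_orbit \<and> length (remdups icosian_orbit) = length icosians"
  by code_simp

lemma simple_roots_icosians: "set simple_roots \<subseteq> set icosians"
  by (auto simp: in_set_icosians is_icosian_def simple_roots_def icosian_shapes_unfold)

text \<open>By counting: the orbit lies inside and has as many distinct members as the list
  \<open>icosians\<close> has entries, so the reverse inclusion needs no search.\<close>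

lemma set_icosian_orbit: "set icosian_orbit = set icosians"
proof (rule card_seteq)
  show "set icosian_orbit \<subseteq> set icosians"
    using icosian_orbit_check by (auto simp: list_all_iff in_set_icosians)
  have "card (set icosians) \<le> length icosians" by (rule card_length)
  also have "\<dots> = card (set icosian_orbit)"
    using icosian_orbit_check by (metis length_remdups_card_conv)
  finally show "card (set icosians) \<le> card (set icosian_orbit)" .
qed simp

lemma golden_neg_reflection_icosian:
  assumes "V \<in> set simple_roots" "X \<in> set icosians"
  shows "golden_neg_reflection V X \<in> set icosians"
    and "neg_reflection (golden_vec V) *\<^sub>v golden_vec X = golden_vec (golden_neg_reflection V X)"
proof -
  have V: "V \<in> set icosians" using assms(1) simple_roots_icosians by blast
  have *: "even (fst (golden_dot V X))" "even (snd (golden_dot V X))" "is_icosian (golden_neg_reflection V X)"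
    using icosians_reflection_check assms by (auto simp: list_all_iff)
  then show "golden_neg_reflection V X \<in> set icosians" by (simp add: in_set_icosians)
  show "neg_reflection (golden_vec V) *\<^sub>v golden_vec X = golden_vec (golden_neg_reflection V X)"
    using icosians_check V assms(2) * by (intro neg_reflection_golden_vec) (auto simp: list_all_iff)
qed

text \<open>The step is a pair of reflections because only pairs give rotations that lift to the
  spin group. Both words of \<open>icosian_orbit\<close> have length four, hence consist of two such
  steps.\<close>

lemma icosians_double_reflection_induct:
  assumes X: "X \<in> set icosians" and base: "P [(2,0),(0,0),(0,0),(0,0)]"
    and step: "\<And>V W X. V \<in> set simple_roots \<Longrightarrow> W \<in> set simple_roots \<Longrightarrow> X \<in> set icosians \<Longrightarrow> P X
      \<Longrightarrow> P (golden_neg_reflection V (golden_neg_reflection W X))"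
  shows "P X"
proof -
  define e e' a b :: "golden list" where "e = [(2,0),(0,0),(0,0),(0,0)]" and "e' = [(0,0),(0,0),(0,0),(2,0)]"
    and "a = [(1,0),(1,0),(1,0),(1,0)]" and "b = [(0,1),(1,0),(-1,1),(0,0)]"
  define Q where "Q Y \<longleftrightarrow> Y \<in> set icosians \<and> P Y" for Y
  have roots: "e \<in> set simple_roots" "e' \<in> set simple_roots" "a \<in> set simple_roots" "b \<in> set simple_roots"
    by (simp_all add: simple_roots_def e_def e'_def a_def b_def)
  have Q_step: "Q (golden_neg_reflection V (golden_neg_reflection W Y))"
    if "V \<in> set simple_roots" "W \<in> set simple_roots" "Q Y" for V W Y
    using that step golden_neg_reflection_icosian(1) by (simp add: Q_def)
  have Q_fold: "Q (fold golden_neg_reflection [V1, V2, V3, V4] Y)"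
    if "V1 \<in> set simple_roots" "V2 \<in> set simple_roots" "V3 \<in> set simple_roots" "V4 \<in> set simple_roots" "Q Y"
    for V1 V2 V3 V4 Y
    using that by (simp add: Q_step)
  have "Q e" using base roots(1) simple_roots_icosians by (auto simp: Q_def e_def)
  from X obtain Y where Y: "Y \<in> set (iterates 4 (fold golden_neg_reflection [b, e, b, a]) e)"
    "X \<in> set (iterates 30 (fold golden_neg_reflection [e, e', b, a]) Y)"
    unfolding set_icosian_orbit[symmetric] icosian_orbit_def Let_def set_concat set_map
      e_def e'_def a_def b_def by blast
  have "Q Y" using iterates_invariant[where Q = Q, OF \<open>Q e\<close> _ Y(1)] Q_fold roots by blast
  then have "Q X" using iterates_invariant[where Q = Q, OF _ _ Y(2)] Q_fold roots by blast
  then show ?thesis by (simp add: Q_def)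
qed

lemma is_icosian_uminus:
  assumes "X \<in> set icosians"
  shows "map golden_uminus X \<in> set icosians" "golden_vec (map golden_uminus X) = - golden_vec X"
proof -
  have uu: "golden_uminus (golden_uminus x) = x" for x by (simp add: golden_uminus_def)
  show "map golden_uminus X \<in> set icosians"
    using assms unfolding in_set_icosians is_icosian_def list_ex_iff list_all2_map1
    by (elim bexE) (rule bexI, erule list_all2_mono, auto simp: uu)
  have "length X = 4" using assms icosians_check by (simp add: list_all_iff)
  then show "golden_vec (map golden_uminus X) = - golden_vec X"
    by (intro eq_vec_5I) (auto simp: golden_vec_index golden_real_uminus simp del: One_nat_def)
qed

lemma cell120_dirsD:
  assumes "u \<in> cell120_dirs"
  shows "u \<in> carrier_vec 5" "u $ 0 = 0" "lform u u = 1" "- u \<in> cell120_dirs"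
    "i < 5 \<Longrightarrow> complex_of_real (u $ i) \<in> half_gauss_sqrt5"
proof -
  obtain X where X: "X \<in> set icosians" "u = golden_vec X" using assms by (auto simp: cell120_dirs_eq)
  then show "u \<in> carrier_vec 5" "u $ 0 = 0" by (simp_all add: golden_vec_index)
  have "length X = 4" "golden_dot X X = (4, 0)" using X icosians_check by (auto simp: list_all_iff)
  with X show "lform u u = 1" by (simp add: lform_golden_vec golden_real_def)
  show "- u \<in> cell120_dirs" using is_icosian_uminus X by (metis cell120_dirs_eq image_eqI)
  have "complex_of_real (golden_real x / 2) \<in> half_gauss_sqrt5" for x
  proof -
    have "complex_of_real (golden_real x / 2)
        = of_int (fst x) * (1 / 2) + of_int (snd x) * (complex_of_real phi * (1 / 2))"
      by (simp add: golden_real_def add_divide_distrib)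
    then show ?thesis
      by (simp only:) (intro half_gauss_sqrt5_add half_gauss_sqrt5_mult half_gauss_sqrt5_basic)
  qed
  then show "complex_of_real (u $ i) \<in> half_gauss_sqrt5" if "i < 5"
    using that half_gauss_sqrt5_basic(2) unfolding X(2) less_5_cases
    by (elim disjE) (simp_all only: golden_vec_index of_real_0)
qed

section \<open>The inradius and the lifted side-pairing maps\<close>

text \<open>For x = 2 pi / 5, cos 3x = cos 2x is a cubic equation in cos x. The root 1 is split off,
  and positivity selects the root of the remaining quadratic.\<close>

lemma cos_2pi_div_5: "cos (2 * pi / 5) = (phi - 1) / 2"
proof -
  define c where "c = cos (2 * pi / 5)"
  have "cos (3 * (2 * pi / 5)) = cos (2 * pi - 2 * (2 * pi / 5))" by (simp add: field_simps)
  also have "\<dots> = cos (2 * (2 * pi / 5))" by (simp only: cos_2pi_minus)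
  finally have "4 * c ^ 3 - 3 * c = 2 * c\<^sup>2 - 1"
    unfolding c_def by (simp only: cos_treble_cos cos_double_cos)
  then have "(c - 1) * (4 * c\<^sup>2 + 2 * c - 1) = 0"
    by (simp add: algebra_simps power3_eq_cube power2_eq_square)
  moreover have "c < 1"
    using cos_monotone_0_pi[of 0 "2 * pi / 5"] pi_gt_zero by (simp add: c_def)
  ultimately have "4 * c\<^sup>2 + 2 * c - 1 = 0" by simp
  then have "(4 * c + 1)\<^sup>2 = 5" by (simp add: power2_eq_square algebra_simps)
  moreover have "c > 0" unfolding c_def by (rule cos_gt_zero) (auto simp: pi_gt_zero)
  ultimately have "4 * c + 1 = sqrt 5" by (intro real_sqrt_unique[symmetric]) auto
  then show ?thesis by (simp add: c_def phi_def field_simps)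
qed

lemma lform_side_normal:
  assumes "u $ 0 = 0" "v $ 0 = 0" "u \<in> carrier_vec 5" "v \<in> carrier_vec 5"
  shows "lform (side_normal r u) (side_normal r v) = - (sinh r)\<^sup>2 + (cosh r)\<^sup>2 * lform u v"
  using assms by (simp add: lform_expand side_normal_def power2_eq_square algebra_simps)

lemma inner4_eq_lform: "u $ 0 = 0 \<Longrightarrow> inner4 u v = lform u v"
  by (simp add: inner4_def lform_def)

text \<open>The angle condition quantifies over adjacent pairs and would be vacuous without one;
  \<open>?e\<close> and \<open>?b\<close> are such a pair. What is left is linear in sinh^2, with 2
  - phi = 1 / phi^2.\<close>

lemma dihedral_angle_is_iff:
  "dihedral_angle_is r (2 * pi / 5) \<longleftrightarrow> (sinh r)\<^sup>2 = phi\<^sup>2 * sqrt 5"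
proof -
  let ?e = "[(2,0),(0,0),(0,0),(0,0)] :: golden list" and ?b = "[(0,1),(1,0),(-1,1),(0,0)] :: golden list"
  have "?e \<in> set icosians" "?b \<in> set icosians"
    using simple_roots_icosians by (auto simp: simple_roots_def)
  moreover have "inner4 (golden_vec ?e) (golden_vec ?b) = phi / 2"
    by (subst inner4_eq_lform)
      (simp_all add: golden_vec_index lform_golden_vec golden_dot_def golden_mult_def golden_real_def)
  ultimately have ex: "\<exists>u\<in>cell120_dirs. \<exists>v\<in>cell120_dirs. inner4 u v = phi / 2"
    unfolding cell120_dirs_eq by blast
  have "- lform (side_normal r u) (side_normal r v) = cos (2 * pi / 5)
      \<longleftrightarrow> (sinh r)\<^sup>2 - (1 + (sinh r)\<^sup>2) * (phi / 2) = (phi - 1) / 2"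
    if "u \<in> cell120_dirs" "v \<in> cell120_dirs" "inner4 u v = phi / 2" for u v
  proof -
    have l: "lform u v = phi / 2" using that cell120_dirsD(2)[OF that(1)] by (simp add: inner4_eq_lform)
    show ?thesis
      unfolding lform_side_normal[OF cell120_dirsD(2)[OF that(1)] cell120_dirsD(2)[OF that(2)]
        cell120_dirsD(1)[OF that(1)] cell120_dirsD(1)[OF that(2)]] l cosh_square_eq cos_2pi_div_5
      by (auto simp: algebra_simps)
  qed
  with ex have "dihedral_angle_is r (2 * pi / 5)
      \<longleftrightarrow> (sinh r)\<^sup>2 - (1 + (sinh r)\<^sup>2) * (phi / 2) = (phi - 1) / 2"
    unfolding dihedral_angle_is_def by blast
  also have "\<dots> \<longleftrightarrow> (sinh r)\<^sup>2 * (2 - phi) = 2 * phi - 1"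
  proof -
    have "2 * ((sinh r)\<^sup>2 - (1 + (sinh r)\<^sup>2) * (phi / 2) - (phi - 1) / 2)
        = (sinh r)\<^sup>2 * (2 - phi) - (2 * phi - 1)" by (simp add: field_simps)
    moreover have "a = b \<longleftrightarrow> c = d" if "2 * (a - b) = c - d" for a b c d :: real
      using that by auto
    ultimately show ?thesis by blast
  qed
  also have "\<dots> \<longleftrightarrow> (sinh r)\<^sup>2 = phi\<^sup>2 * sqrt 5"
  proof -
    have "phi\<^sup>2 * (2 - phi) = (phi + 1) * (2 - phi)" by (simp only: power2_eq_square phi_square)
    also have "\<dots> = 1" using phi_square by (simp add: algebra_simps)
    finally have *: "phi\<^sup>2 * (2 - phi) = 1" .
    have "phi\<^sup>2 * sqrt 5 * (2 - phi) = (phi\<^sup>2 * (2 - phi)) * sqrt 5" by (simp only: mult_ac)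
    then have "phi\<^sup>2 * sqrt 5 * (2 - phi) = 2 * phi - 1" unfolding * by (simp add: sqrt_5_eq)
    moreover have "2 - phi \<noteq> 0" using * by auto
    ultimately show ?thesis by (metis mult_right_cancel)
  qed
  finally show ?thesis .
qed

text \<open>A positive r has positive sinh, so its square determines r and the \<open>THE\<close> is
  well defined; cosh follows from phi^2 * sqrt 5 + 1 = (phi + 1)^2.\<close>

lemma davis_inradius: "sinh davis_inradius = phi * sqrt (sqrt 5)" "cosh davis_inradius = phi + 1"
proof -
  let ?s = "phi * sqrt (sqrt 5)"
  have s: "?s > 0" using phi_pos by simp
  have ss: "?s\<^sup>2 = phi\<^sup>2 * sqrt 5" by (simp add: power_mult_distrib)
  have eq: "davis_inradius = arsinh ?s"
    unfolding davis_inradius_def dihedral_angle_is_iff ss[symmetric]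
  proof (rule the_equality)
    have "arsinh ?s > arsinh 0" using s by (simp only: arsinh_less_iff_real)
    then show "arsinh ?s > 0 \<and> (sinh (arsinh ?s))\<^sup>2 = ?s\<^sup>2" by (simp only: arsinh_0 sinh_arsinh_real simp_thms)
    fix r :: real assume r: "r > 0 \<and> (sinh r)\<^sup>2 = ?s\<^sup>2"
    then have "sinh r = ?s" using power2_eq_imp_eq[of "sinh r" ?s] s by simp
    then show "r = arsinh ?s" using arsinh_sinh_real[of r] by (simp only:)
  qed
  show sinh: "sinh davis_inradius = ?s" by (subst eq, rule sinh_arsinh_real)
  have "phi\<^sup>2 * sqrt 5 + 1 = (phi + 1) * (2 * phi - 1) + 1"
    by (simp only: power2_eq_square phi_square sqrt_5_eq)
  also have "\<dots> = (phi + 1)\<^sup>2"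
    using phi_square by (simp add: power2_eq_square algebra_simps)
  finally have "(cosh davis_inradius)\<^sup>2 = (phi + 1)\<^sup>2"
    unfolding cosh_square_eq sinh ss .
  then show "cosh davis_inradius = phi + 1"
    using power2_eq_imp_eq[of "cosh davis_inradius" "phi + 1"] phi_pos by simp
qed

text \<open>The point (cosh r, sinh r u) of the hyperboloid: the foot of the perpendicular from the
  center to the side with direction \<open>u\<close>.\<close>

definition davis_axis :: "real vec \<Rightarrow> real vec" where
  "davis_axis u = (phi + 1) \<cdot>\<^sub>v unit_vec 5 0 + (phi * sqrt (sqrt 5)) \<cdot>\<^sub>v u"

definition davis_spinor :: "real vec \<Rightarrow> complex mat" where
  "davis_spinor u = cliff (davis_axis u) * cliff (unit_vec 5 0)"

lemma davis_sinh_square: "(phi * sqrt (sqrt 5)) * (phi * sqrt (sqrt 5)) = 3 * phi + 1"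
proof -
  have "(phi * sqrt (sqrt 5)) * (phi * sqrt (sqrt 5)) = (phi * phi) * sqrt 5" by simp
  also have "\<dots> = 3 * phi + 1"
    unfolding phi_square sqrt_5_eq using phi_square by (simp add: algebra_simps)
  finally show ?thesis .
qed

lemma davis_axis_carrier: "u \<in> carrier_vec 5 \<Longrightarrow> davis_axis u \<in> carrier_vec 5"
  by (simp add: davis_axis_def)

lemma davis_axis_index:
  assumes "u \<in> carrier_vec 5" "u $ 0 = 0" "i < 5"
  shows "davis_axis u $ i = (if i = 0 then phi + 1 else phi * sqrt (sqrt 5) * u $ i)"
  using assms by (auto simp: davis_axis_def)

lemma lform_davis_axis:
  assumes "u \<in> carrier_vec 5" "u $ 0 = 0" "lform u u = 1"
  shows "lform (davis_axis u) (davis_axis u) = - 1"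
proof -
  have "lform (davis_axis u) (davis_axis u) = - ((phi + 1) * (phi + 1))
     + ((phi * sqrt (sqrt 5)) * (phi * sqrt (sqrt 5))) * lform u u"
    using assms(1,2) by (simp add: lform_expand davis_axis_index algebra_simps)
  then show ?thesis using phi_square unfolding davis_sinh_square by (simp add: assms(3) algebra_simps)
qed

lemma lform_time_axis: "lform (unit_vec 5 0) (unit_vec 5 0) = - 1"
  by (simp add: lform_unit_vec)

lemma davis_spinor_spin41p: "u \<in> cell120_dirs \<Longrightarrow> davis_spinor u \<in> spin41p"
  unfolding davis_spinor_def
  using cell120_dirsD[of u] lform_davis_axis[of u] lform_time_axis
  by (intro spin41p_pair davis_axis_carrier) auto

lemma hyp_translation_index_vec:
  assumes "u \<in> carrier_vec 5" "u $ 0 = 0" "x \<in> carrier_vec 5" "i < 5"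
  shows "(hyp_translation u d *\<^sub>v x) $ i = x $ i
    + (cosh d - 1) * ((if i = 0 then x $ 0 else 0) + u $ i * lform u x)
    + sinh d * ((if i = 0 then lform u x else 0) + u $ i * x $ 0)"
proof -
  have "hyp_translation u d \<in> carrier_mat 5 5" by (simp add: hyp_translation_def)
  with assms show ?thesis
    unfolding less_5_cases
    by (elim disjE) (simp_all add: index_mult_mat_vec_5 hyp_translation_def lform_expand algebra_simps
        del: index_mult_mat_vec)
qed

text \<open>For timelike \<open>v\<close>, \<open>neg_reflection v\<close> is the point reflection
  in \<open>v\<close>. The point reflection in the center followed by that in the foot point at
  distance r is the translation by 2r, in accordance with the double-argument formulas for sinh and
  cosh.\<close>

lemma eta_davis_spinor:
  assumes "u \<in> cell120_dirs"
  shows "eta (davis_spinor u) = hyp_translation u (2 * davis_inradius)"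
proof -
  note u = cell120_dirsD[OF assms]
  define c s where "c = phi + 1" and "s = phi * sqrt (sqrt 5)"
  have cs: "c * c = s * s + 1"
    unfolding c_def s_def davis_sinh_square using phi_square by (simp add: algebra_simps)
  let ?e = "unit_vec 5 0 :: real vec" and ?a = "davis_axis u"
  have a: "?a \<in> carrier_vec 5" "lform ?a ?a = - 1"
    using u by (simp_all add: davis_axis_carrier lform_davis_axis)
  have ai: "?a $ i = (if i = 0 then c else s * u $ i)" if "i < 5" for i
    using that u by (simp add: davis_axis_index c_def s_def)
  have cd: "cosh (2 * davis_inradius) - 1 = 2 * (s * s)" and sd: "sinh (2 * davis_inradius) = 2 * (s * c)"
    using cs by (simp_all add: cosh_double sinh_double davis_inradius power2_eq_square c_def s_def)
  have "eta (davis_spinor u) = neg_reflection ?a * neg_reflection ?e"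
    unfolding davis_spinor_def using a lform_time_axis by (intro eta_pair) auto
  also have "\<dots> = hyp_translation u (2 * davis_inradius)"
  proof (rule mat_eq_if_mult_vec_eq[where m = 5 and n = 5])
    show "neg_reflection ?a * neg_reflection ?e \<in> carrier_mat 5 5" by (auto intro: mult_carrier_mat[of _ 5 5])
    show H: "hyp_translation u (2 * davis_inradius) \<in> carrier_mat 5 5" by (simp add: hyp_translation_def)
    fix x :: "real vec" assume x: "x \<in> carrier_vec 5"
    define y where "y = neg_reflection ?e *\<^sub>v x"
    have yc: "y \<in> carrier_vec 5" using x by (simp add: y_def mult_mat_vec_carrier[of _ 5 5])
    have y: "y $ i = (if i = 0 then x $ 0 else - x $ i)" if "i < 5" for i
      using x that lform_time_axis
      by (auto simp: y_def neg_reflection_mult_vec lform_commute[of ?e x] lform_unit_vec)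
    have ay: "lform ?a y = - (c * x $ 0) - s * lform u x"
      using u x by (simp add: lform_expand ai y algebra_simps)
    have "neg_reflection ?a *\<^sub>v y = (2 * (c * x $ 0 + s * lform u x)) \<cdot>\<^sub>v ?a - y"
      using a yc by (simp add: neg_reflection_mult_vec ay add.commute)
    moreover have "((2 * (c * x $ 0 + s * lform u x)) \<cdot>\<^sub>v ?a - y) $ i = (hyp_translation u (2 * davis_inradius) *\<^sub>v x) $ i"
      if i: "i < 5" for i
    proof -
      define L where "L = lform u x"
      have "2 * (c * x $ 0 + s * L) * c - x $ 0 = 2 * (c * c) * x $ 0 + 2 * (s * c) * L - x $ 0"
        by (simp add: algebra_simps)
      also have "\<dots> = x $ 0 + 2 * (s * s) * x $ 0 + 2 * (s * c) * L"
        unfolding cs by (simp add: algebra_simps)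
      finally have 0: "2 * (c * x $ 0 + s * L) * c - x $ 0 = x $ 0 + 2 * (s * s) * x $ 0 + 2 * (s * c) * L" .
      have "((2 * (c * x $ 0 + s * L)) \<cdot>\<^sub>v ?a - y) $ i = 2 * (c * x $ 0 + s * L) * ?a $ i - y $ i"
        using i a yc by simp
      also have "\<dots> = (hyp_translation u (2 * davis_inradius) *\<^sub>v x) $ i"
      proof (cases "i = 0")
        case True
        then show ?thesis using u(1,2) x 0
          by (simp add: hyp_translation_index_vec cd sd ai y L_def)
      next
        case False
        then show ?thesis using u(1,2) x i
          by (simp add: hyp_translation_index_vec cd sd ai y flip: L_def) (simp add: algebra_simps)
      qed
      finally show ?thesis by (simp only: L_def)
    qed
    moreover have "neg_reflection ?a * neg_reflection ?e *\<^sub>v x = neg_reflection ?a *\<^sub>v y"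
      using x by (simp add: y_def assoc_mult_mat_vec[of _ 5 5 _ 5])
    ultimately show "neg_reflection ?a * neg_reflection ?e *\<^sub>v x = hyp_translation u (2 * davis_inradius) *\<^sub>v x"
      using H x yc a by (intro eq_vecI) auto
  qed
  finally show ?thesis .
qed

lemma davis_spinor_index:
  assumes "i < 4" "j < 4"
  shows "davis_spinor u $$ (i, j) = cliff (davis_axis u) $$ (i, j) * (if j < 2 then \<i> else - \<i>)"
  using assms unfolding davis_spinor_def less_4_cases
  by (elim disjE) (simp_all add: index_mult_mat_4 cliff_index del: index_mult_mat(1) One_nat_def)

lemma davis_spinor_carrier [simp]: "davis_spinor u \<in> carrier_mat 4 4"
  by (auto simp: davis_spinor_def intro: mult_carrier_mat[of _ 4 4])

text \<open>The sign of the lift is decided here: sqrt 5 * phi = phi + 2 makes c = phi + 1 congruent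
  to -1, so that -c, not c, is congruent to 1.\<close>

lemma davis_spinor_congruence:
  assumes "u \<in> cell120_dirs"
  shows "davis_spinor u \<in> congruence_group"
proof -
  note u = cell120_dirsD[OF assms]
  have ui: "complex_of_real (u $ i) \<in> half_gauss_sqrt5" if "i < 5" for i using u that by blast
  note ring = half_gauss_sqrt5_add half_gauss_sqrt5_mult half_gauss_sqrt5_diff half_gauss_sqrt5_uminus half_gauss_sqrt5_basic
  have uij: "cliff u $$ (i, j) \<in> half_gauss_sqrt5" if "i < 4" "j < 4" for i j
    using that u(2) ui[of 1] ui[of 2] ui[of 3] ui[of 4] unfolding less_4_cases
    by (elim disjE) (auto simp: cliff_index simp del: One_nat_def intro!: ring)
  have diag: "davis_spinor u $$ (i, j) - (if i = j then 1 else 0) = complex_of_real (sqrt 5) * (if i = j then - complex_of_real phi else 0)"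
    if "i < 4" "j < 4" "i div 2 = j div 2" for i j
  proof -
    have "sqrt 5 * phi = phi + 2" unfolding sqrt_5_eq using phi_square by (simp add: algebra_simps)
    then have 5: "complex_of_real (sqrt 5) * complex_of_real phi = complex_of_real phi + 2"
      by (metis of_real_add of_real_mult of_real_numeral)
    show ?thesis
      using that u unfolding less_4_cases
      by (elim disjE) (simp_all add: davis_spinor_index cliff_index davis_axis_index
        5 5[unfolded mult.commute[of "complex_of_real (sqrt 5)"]] algebra_simps del: One_nat_def)
  qed
  have off: "davis_spinor u $$ (i, j) = complex_of_real (sqrt (sqrt 5)) *
      (complex_of_real phi * cliff u $$ (i, j) * (if j < 2 then \<i> else - \<i>))"
    if "i < 4" "j < 4" "i div 2 \<noteq> j div 2" for i j
    using that u unfolding less_4_cases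
    by (elim disjE) (simp_all add: davis_spinor_index cliff_index davis_axis_index algebra_simps del: One_nat_def)
  have "\<exists>z\<in>half_gauss_sqrt5. (davis_spinor u - 1\<^sub>m 4) $$ (i, j) = block_weight i j * z"
    if ij: "i < 4" "j < 4" for i j
  proof (cases "i div 2 = j div 2")
    case True
    with diag[OF ij] ij show ?thesis
      by (auto simp: block_weight_def intro!: bexI[of _ "if i = j then - complex_of_real phi else 0"] ring)
  next
    case False
    then have "i \<noteq> j" by auto
    with False off[OF ij] ij show ?thesis
      by (intro bexI[of _ "complex_of_real phi * cliff u $$ (i, j) * (if j < 2 then \<i> else - \<i>)"])
        (auto simp: block_weight_def intro!: ring uij)
  qed
  then show ?thesis by (simp add: congruence_group_def congruence_ideal_def minus_carrier_mat)
qed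

section \<open>The ridge relation\<close>

text \<open>The element \<open>p + q X + r Y + t X Y\<close>, where \<open>X\<close> and \<open>Y\<close> are the Clifford products of
  \<open>(1, 0, 0, 0)\<close> and \<open>(0, 1/2, k, 0)\<close> with the time axis.\<close>
definition plane_mat :: "real \<Rightarrow> real \<Rightarrow> real \<Rightarrow> real \<Rightarrow> real \<Rightarrow> complex mat" where
  "plane_mat k p q r t = mat 4 4 (\<lambda>(i, j).
    [[Complex p (t / 2), Complex (- k * t) 0, Complex 0 (- k * r), Complex (- r / 2) (- q)],
     [Complex (k * t) 0, Complex p (- t / 2), Complex (r / 2) (- q), Complex 0 (k * r)],
     [Complex 0 (k * r), Complex (r / 2) q, Complex p (t / 2), Complex (- k * t) 0],
     [Complex (- r / 2) q, Complex 0 (- k * r), Complex (k * t) 0, Complex p (- t / 2)]] ! i ! j)"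

lemma plane_mat_carrier [simp]: "plane_mat k p q r t \<in> carrier_mat 4 4"
  by (simp add: plane_mat_def)

lemma plane_mat_index:
  "plane_mat k p q r t $$ (0, 0) = Complex p (t / 2)" "plane_mat k p q r t $$ (0, 1) = Complex (- k * t) 0"
  "plane_mat k p q r t $$ (0, 2) = Complex 0 (- k * r)" "plane_mat k p q r t $$ (0, 3) = Complex (- r / 2) (- q)"
  "plane_mat k p q r t $$ (1, 0) = Complex (k * t) 0" "plane_mat k p q r t $$ (1, 1) = Complex p (- t / 2)"
  "plane_mat k p q r t $$ (1, 2) = Complex (r / 2) (- q)" "plane_mat k p q r t $$ (1, 3) = Complex 0 (k * r)"
  "plane_mat k p q r t $$ (2, 0) = Complex 0 (k * r)" "plane_mat k p q r t $$ (2, 1) = Complex (r / 2) q"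
  "plane_mat k p q r t $$ (2, 2) = Complex p (t / 2)" "plane_mat k p q r t $$ (2, 3) = Complex (- k * t) 0"
  "plane_mat k p q r t $$ (3, 0) = Complex (- r / 2) q" "plane_mat k p q r t $$ (3, 1) = Complex 0 (- k * r)"
  "plane_mat k p q r t $$ (3, 2) = Complex (k * t) 0" "plane_mat k p q r t $$ (3, 3) = Complex p (- t / 2)"
  by (simp_all add: plane_mat_def)

text \<open>The relations X^2 = 1, Y^2 = m and Y X = - X Y, hence (X Y)^2 = - m: a quaternion
  algebra, so four coordinates replace sixteen entries.\<close>

lemma plane_mat_mult:
  fixes k :: real
  defines "m \<equiv> 1 / 4 + k * k"
  shows "plane_mat k p q r t * plane_mat k p' q' r' t'
    = plane_mat k (p * p' + q * q' + m * r * r' - m * t * t') (p * q' + q * p' - m * r * t' + m * t * r')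
        (p * r' + r * p' + q * t' - t * q') (p * t' + t * p' + q * r' - r * q')"
  unfolding m_def
  by (rule eq_mat_4I, rule mult_carrier_mat[of _ 4 4], simp, simp, simp, unfold less_4_cases, elim disjE;
      simp add: index_mult_mat_4 plane_mat_index complex_eq_iff del: index_mult_mat(1) One_nat_def;
      simp add: algebra_simps)

lemma plane_mat_one: "plane_mat k 1 0 0 0 = 1\<^sub>m 4"
  by (rule eq_mat_4I) (auto simp: less_4_cases plane_mat_index complex_eq_iff simp del: One_nat_def)

lemma davis_spinor_plane:
  assumes "u \<in> carrier_vec 5" "u $ 0 = 0" "u $ 1 = x" "u $ 2 = y / 2" "u $ 3 = k * y" "u $ 4 = 0"
  shows "davis_spinor u = plane_mat k (- (phi + 1)) (phi * sqrt (sqrt 5) * x) (phi * sqrt (sqrt 5) * y) 0"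
  using assms
  by (intro eq_mat_4I, simp, simp, unfold less_4_cases, elim disjE;
      simp add: davis_spinor_index cliff_index davis_axis_index plane_mat_index complex_eq_iff del: One_nat_def)

text \<open>Around each ridge of the tessellation there are five 120-cells; the resulting ridge relation
  lifts to a relation with positive sign.\<close>
lemma davis_spinor_pentagram:
  "\<exists>X0 X1 X2 X3 X4. set [X0, X1, X2, X3, X4] \<subseteq> set icosians \<and>
     davis_spinor (golden_vec X0) * davis_spinor (golden_vec X1) * davis_spinor (golden_vec X2)
       * davis_spinor (golden_vec X3) * davis_spinor (golden_vec X4) = 1\<^sub>m 4"
proof (intro exI conjI)
  \<comment> \<open>Five unit vectors in the plane of (1,0,0,0) and (0,1/2,k,0), each turned by 4 pi
    / 5 against its predecessor, so that they run through a pentagram.\<close>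
  let ?X0 = "[(2,0),(0,0),(0,0),(0,0)] :: golden list" and ?X1 = "[(0,-1),(1,0),(-1,1),(0,0)] :: golden list"
    and ?X2 = "[(-1,1),(0,-1),(-1,0),(0,0)] :: golden list" and ?X3 = "[(-1,1),(0,1),(1,0),(0,0)] :: golden list"
    and ?X4 = "[(0,-1),(-1,0),(1,-1),(0,0)] :: golden list"
  show "set [?X0, ?X1, ?X2, ?X3, ?X4] \<subseteq> set icosians"
    by (simp add: in_set_icosians is_icosian_def icosian_shapes_unfold golden_uminus_def)
  define k s where "k = (phi - 1) / 2" and "s = phi * sqrt (sqrt 5)"
  have phi2: "phi * (phi * z) = phi * z + z" for z
    using phi_square by (metis distrib_right mult.assoc mult_1)
  have kp: "k * phi = 1 / 2" using phi_square by (simp add: k_def field_simps)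
  have S: "davis_spinor (golden_vec ?X0) = plane_mat k (- (phi + 1)) (s * 1) (s * 0) 0"
    "davis_spinor (golden_vec ?X1) = plane_mat k (- (phi + 1)) (s * (- phi / 2)) (s * 1) 0"
    "davis_spinor (golden_vec ?X2) = plane_mat k (- (phi + 1)) (s * k) (s * (- phi)) 0"
    "davis_spinor (golden_vec ?X3) = plane_mat k (- (phi + 1)) (s * k) (s * phi) 0"
    "davis_spinor (golden_vec ?X4) = plane_mat k (- (phi + 1)) (s * (- phi / 2)) (s * (- 1)) 0"
    unfolding s_def
    by (rule davis_spinor_plane; simp add: golden_vec_index golden_real_def kp del: One_nat_def; simp add: k_def field_simps)+
  have kk: "1 / 4 + k * k = (3 - phi) / 4"
    using phi_square by (simp add: k_def field_simps)
  have ss: "s * s = 3 * phi + 1" unfolding s_def by (rule davis_sinh_square)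
  have ss2: "s * (s * z) = 3 * (phi * z) + z" for z
    using ss by (metis distrib_right mult.assoc mult_1)
  have cong: "plane_mat k p q r t = plane_mat k p' q' r' t'"
    if "p = p'" "q = q'" "r = r'" "t = t'" for p q r t p' q' r' t' using that by simp
  \<comment> \<open>In every product p and t contain only even powers of s, q and r only odd ones.
    With s^2 = 3 phi + 1 and phi^2 = phi + 1 each coordinate becomes an identity with rational
    coefficients in phi, times s for q and r.\<close>
  note rules = algebra_simps phi_square phi2 ss ss2 add_divide_distrib diff_divide_distrib
  have 1: "plane_mat k (- (phi + 1)) (s * 1) (s * 0) 0 * plane_mat k (- (phi + 1)) (s * (- phi / 2)) (s * 1) 0
      = plane_mat k (1 / 2 + phi) (- s / 2) (- s * (1 + phi)) (1 + 3 * phi)"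
    unfolding plane_mat_mult kk by (rule cong) (simp_all add: rules)
  have 2: "plane_mat k (1 / 2 + phi) (- s / 2) (- s * (1 + phi)) (1 + 3 * phi)
      * plane_mat k (- (phi + 1)) (s * k) (s * (- phi)) 0
      = plane_mat k (1 / 2 + phi) (- s * (1 + phi) / 2) (s * phi) (- 1 - 3 * phi)"
    unfolding plane_mat_mult kk by (rule cong) (simp_all add: k_def rules)
  have 3: "plane_mat k (1 / 2 + phi) (- s * (1 + phi) / 2) (s * phi) (- 1 - 3 * phi)
      * plane_mat k (- (phi + 1)) (s * k) (s * phi) 0
      = plane_mat k (- 1 - phi) (s * phi / 2) s 0"
    unfolding plane_mat_mult kk by (rule cong) (simp_all add: k_def rules)
  have 4: "plane_mat k (- 1 - phi) (s * phi / 2) s 0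
      * plane_mat k (- (phi + 1)) (s * (- phi / 2)) (s * (- 1)) 0
      = plane_mat k 1 0 0 0"
    unfolding plane_mat_mult kk by (rule cong) (simp_all add: rules)
  show "davis_spinor (golden_vec ?X0) * davis_spinor (golden_vec ?X1) * davis_spinor (golden_vec ?X2)
       * davis_spinor (golden_vec ?X3) * davis_spinor (golden_vec ?X4) = 1\<^sub>m 4"
    unfolding S 1 2 3 4 by (rule plane_mat_one)
qed

section \<open>The symmetric spin structure\<close>

lemma gen_group_carrier:
  assumes "\<And>s. s \<in> S \<Longrightarrow> s \<in> carrier_mat n n" "g \<in> gen_group n S"
  shows "g \<in> carrier_mat n n"
  using assms(2) by induction (auto intro: mult_carrier_mat assms(1))

text \<open>A left inverse of a generator coincides with its right inverse in \<open>S\<close>, so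
  the rule for inverses in \<open>gen_group\<close> is an instance of the rule for
  generators.\<close>

lemma gen_group_induct_symmetric [consumes 1, case_names symmetric one mult]:
  assumes "g \<in> gen_group n S"
    and sym: "\<And>s. s \<in> S \<Longrightarrow> s \<in> carrier_mat n n \<and> (\<exists>t\<in>S. s * t = 1\<^sub>m n)"
    and one: "P (1\<^sub>m n)"
    and mult: "\<And>g s. g \<in> gen_group n S \<Longrightarrow> s \<in> S \<Longrightarrow> P g \<Longrightarrow> P (s * g)"
  shows "P g"
  using assms(1)
proof induction
  case (inv g s t)
  obtain t' where t': "t' \<in> S" "s * t' = 1\<^sub>m n" using sym inv by blast
  have carr: "s \<in> carrier_mat n n" "t' \<in> carrier_mat n n" using sym inv t' by blast+
  have "t = t * (s * t')" using inv t' by simp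
  also have "\<dots> = t * s * t'" using inv carr by (intro assoc_mult_mat[symmetric]) auto
  also have "\<dots> = t'" using inv carr by simp
  finally show ?case using mult inv t' by simp
qed (use one mult in auto)

lemma gen_group_mult_closed:
  assumes g: "g \<in> gen_group n S" and h: "h \<in> gen_group n S"
    and sym: "\<And>s. s \<in> S \<Longrightarrow> s \<in> carrier_mat n n \<and> (\<exists>t\<in>S. s * t = 1\<^sub>m n)"
  shows "g * h \<in> gen_group n S"
  using g
proof (induction rule: gen_group_induct_symmetric)
  case one
  then show ?case using h gen_group_carrier[of S n h] sym by simp
next
  case (mult g s)
  have "s * g * h = s * (g * h)"
    using mult sym gen_group_carrier[of S n] h by (intro assoc_mult_mat[of _ n n _ n _ n]) blast+
  with mult show ?case by (simp add: gen_group.mult)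
qed (fact sym)

lemma gen_group_inverse:
  assumes g: "g \<in> gen_group n S"
    and sym: "\<And>s. s \<in> S \<Longrightarrow> s \<in> carrier_mat n n \<and> (\<exists>t\<in>S. t * s = 1\<^sub>m n \<and> s * t = 1\<^sub>m n)"
  shows "\<exists>h\<in>gen_group n S. h * g = 1\<^sub>m n"
  using g
proof (induction rule: gen_group_induct_symmetric)
  case symmetric
  then show ?case using sym by blast
next
  case one
  then show ?case by (intro bexI[of _ "1\<^sub>m n"]) (auto intro: gen_group.one)
next
  case (mult g s)
  then obtain h where h: "h \<in> gen_group n S" "h * g = 1\<^sub>m n" by blast
  obtain t where t: "t \<in> S" "t * s = 1\<^sub>m n" using sym mult by blast
  have c: "g \<in> carrier_mat n n" "h \<in> carrier_mat n n" "s \<in> carrier_mat n n" "t \<in> carrier_mat n n"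
    using gen_group_carrier[of S n] sym mult h t by blast+
  have "t * 1\<^sub>m n \<in> gen_group n S" using t by (intro gen_group.mult gen_group.one)
  then have "t \<in> gen_group n S" using c by simp
  then have "h * t \<in> gen_group n S" using h sym by (intro gen_group_mult_closed) blast+
  moreover have "h * t * (s * g) = 1\<^sub>m n"
    using mult_mat_cancel_middle[of h n t s g] c t h by simp
  ultimately show ?case by blast
qed

definition davis_spinors :: "complex mat set" where
  "davis_spinors = davis_spinor ` cell120_dirs"

definition davis_spin_group :: "complex mat set" where
  "davis_spin_group = gen_group 4 davis_spinors"

text \<open>Conjugation by the time axis reverses space and turns the axis a of \<open>u\<close>
  into that of \<open>- u\<close>; so the lift for \<open>- u\<close> is e0 a, the inverse of a e0.
  No sign appears, hence the chosen lifts are closed under inverses.\<close>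

lemma davis_spinor_inverse:
  assumes "u \<in> cell120_dirs"
  shows "davis_spinor u * davis_spinor (- u) = 1\<^sub>m 4" "davis_spinor (- u) * davis_spinor u = 1\<^sub>m 4"
proof -
  note u = cell120_dirsD[OF assms]
  let ?e = "unit_vec 5 0 :: real vec" and ?a = "davis_axis u"
  have a: "?a \<in> carrier_vec 5" "lform ?a ?a = - 1" using u by (simp_all add: davis_axis_carrier lform_davis_axis)
  have [simp]: "dim_vec ?a = 5" using a by simp
  have "lform ?e ?a = - (phi + 1)"
    using u a by (subst lform_commute) (simp add: lform_unit_vec davis_axis_index)
  then have "neg_reflection ?e *\<^sub>v ?a = davis_axis (- u)"
    using u a lform_time_axis
    by (intro eq_vec_5I) (auto simp: neg_reflection_mult_vec davis_axis_index davis_axis_carrier simp del: One_nat_def)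
  then have "davis_spinor (- u) = cliff ?e * cliff ?a"
    unfolding davis_spinor_def using a lform_time_axis by (subst cliff_neg_reflection) auto
  then show "davis_spinor u * davis_spinor (- u) = 1\<^sub>m 4" "davis_spinor (- u) * davis_spinor u = 1\<^sub>m 4"
    using a lform_time_axis by (simp_all add: davis_spinor_def cliff_pair_inverse)
qed

lemma davis_spinors_symmetric:
  "s \<in> davis_spinors \<Longrightarrow> s \<in> carrier_mat 4 4 \<and> (\<exists>t\<in>davis_spinors. t * s = 1\<^sub>m 4 \<and> s * t = 1\<^sub>m 4)"
  unfolding davis_spinors_def using davis_spinor_inverse cell120_dirsD(4) by fastforce

lemma davis_spinors_symmetric':
  "s \<in> davis_spinors \<Longrightarrow> s \<in> carrier_mat 4 4 \<and> (\<exists>t\<in>davis_spinors. s * t = 1\<^sub>m 4)"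
  using davis_spinors_symmetric by blast

lemma davis_side_pairings_eq: "davis_side_pairings = eta ` davis_spinors"
  unfolding davis_side_pairings_def davis_spinors_def using eta_davis_spinor by (auto simp: image_iff)

lemma davis_spinors_spin41p: "s \<in> davis_spinors \<Longrightarrow> s \<in> spin41p"
  by (auto simp: davis_spinors_def davis_spinor_spin41p)

lemma davis_side_pairings_symmetric:
  assumes "s \<in> davis_side_pairings"
  shows "s \<in> carrier_mat 5 5 \<and> (\<exists>t\<in>davis_side_pairings. s * t = 1\<^sub>m 5)"
proof -
  obtain s' where s': "s' \<in> davis_spinors" "s = eta s'" using assms by (auto simp: davis_side_pairings_eq)
  obtain t' where t': "t' \<in> davis_spinors" "s' * t' = 1\<^sub>m 4" using davis_spinors_symmetric'[OF s'(1)] by blast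
  have "s * eta t' = 1\<^sub>m 5"
    using eta_mult[of s' t'] s' t' davis_spinors_spin41p eta_one by simp
  then show ?thesis using s' t' davis_spinors_spin41p eta_carrier davis_side_pairings_eq by blast
qed

lemma davis_spin_group_induct [consumes 1, case_names one mult]:
  assumes "g \<in> davis_spin_group" "P (1\<^sub>m 4)"
    "\<And>g s. g \<in> davis_spin_group \<Longrightarrow> s \<in> davis_spinors \<Longrightarrow> P g \<Longrightarrow> P (s * g)"
  shows "P g"
  using assms unfolding davis_spin_group_def
  by (induction rule: gen_group_induct_symmetric) (use davis_spinors_symmetric' in auto)

lemma davis_spin_group_spin41p: "g \<in> davis_spin_group \<Longrightarrow> g \<in> spin41p"
  by (induction rule: davis_spin_group_induct) (auto intro: spin41p.one spin41p_mult davis_spinors_spin41p)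

lemma davis_spin_group_congruence: "g \<in> davis_spin_group \<Longrightarrow> g \<in> congruence_group"
  by (induction rule: davis_spin_group_induct)
    (auto simp: davis_spinors_def intro: congruence_group_one congruence_group_mult davis_spinor_congruence)

lemma eta_davis_spin_group: "eta ` davis_spin_group = davis_Gamma"
proof (intro equalityI subsetI)
  fix x assume "x \<in> eta ` davis_spin_group"
  then obtain g where g: "g \<in> davis_spin_group" "x = eta g" by blast
  from g(1) have "eta g \<in> davis_Gamma"
  proof (induction rule: davis_spin_group_induct)
    case one
    then show ?case by (simp add: eta_one davis_Gamma_def gen_group.one)
  next
    case (mult g s)
    then have "eta (s * g) = eta s * eta g" by (intro eta_mult davis_spinors_spin41p davis_spin_group_spin41p)
    with mult show ?case by (auto simp: davis_Gamma_def davis_side_pairings_eq intro: gen_group.mult)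
  qed
  with g show "x \<in> davis_Gamma" by simp
next
  fix x assume "x \<in> davis_Gamma"
  then show "x \<in> eta ` davis_spin_group"
    unfolding davis_Gamma_def
  proof (induction rule: gen_group_induct_symmetric)
    case (symmetric s)
    then show ?case by (rule davis_side_pairings_symmetric)
  next
    case one
    then show ?case using eta_one gen_group.one unfolding davis_spin_group_def by (metis image_eqI)
  next
    case (mult g s)
    then obtain g' s' where "g' \<in> davis_spin_group" "g = eta g'" "s' \<in> davis_spinors" "s = eta s'"
      by (auto simp: davis_side_pairings_eq)
    moreover from this have "s * g = eta (s' * g')"
      using eta_mult davis_spinors_spin41p davis_spin_group_spin41p by simp
    ultimately show ?case unfolding davis_spin_group_def by (auto intro: gen_group.mult)
  qed
qed

lemma davis_spin_group_neq_uminus: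
  assumes "g \<in> davis_spin_group" "h \<in> davis_spin_group"
  shows "g \<noteq> - h"
proof
  assume "g = - h"
  then have "mat_trace_4 g = - mat_trace_4 h"
    using mat_trace_4_uminus[OF spin41p_carrier[OF davis_spin_group_spin41p[OF assms(2)]]] by simp
  then show False
    using congruence_group_trace_neq_uminus assms[THEN davis_spin_group_congruence] by blast
qed

lemma is_spin_structure_davis: "is_spin_structure davis_spin_group"
  unfolding is_spin_structure_def
proof (intro conjI ballI)
  show "davis_spin_group \<subseteq> spin41p" using davis_spin_group_spin41p by blast
  show "1\<^sub>m 4 \<in> davis_spin_group" by (simp add: davis_spin_group_def gen_group.one)
  show "g * h \<in> davis_spin_group" if "g \<in> davis_spin_group" "h \<in> davis_spin_group" for g h
    using that davis_spinors_symmetric' unfolding davis_spin_group_def by (intro gen_group_mult_closed)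
  show "\<exists>h\<in>davis_spin_group. h * g = 1\<^sub>m 4" if "g \<in> davis_spin_group" for g
    using that davis_spinors_symmetric unfolding davis_spin_group_def by (intro gen_group_inverse)
  show "inj_on eta davis_spin_group"
  proof (rule inj_onI)
    fix g h assume "g \<in> davis_spin_group" "h \<in> davis_spin_group" "eta g = eta h"
    then show "g = h"
      using eta_eq_imp[of g h] davis_spin_group_spin41p davis_spin_group_neq_uminus by blast
  qed
  show "eta ` davis_spin_group = davis_Gamma" by (rule eta_davis_spin_group)
qed

text \<open>Conjugation preserves traces, and modulo \<open>sqrt 5\<close> the trace separates the lifts \<open>g\<close> and
  \<open>- g\<close> of an element of \<open>davis_Gamma\<close>.\<close>
lemma davis_spin_group_conjugate:
  assumes f: "f \<in> spin41p" and g: "g \<in> davis_spin_group" and k: "k \<in> davis_spin_group"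
    and eq: "eta f * eta g = eta k * eta f"
  shows "f * g = k * f"
proof -
  note spin = f davis_spin_group_spin41p[OF g] davis_spin_group_spin41p[OF k]
  note carr = spin[THEN spin41p_carrier]
  obtain h where h: "h \<in> spin41p" "f * h = 1\<^sub>m 4" "h * f = 1\<^sub>m 4" using spin41p_inverse[OF f] by blast
  note hc = spin41p_carrier[OF h(1)]
  have "eta (f * g) = eta (k * f)" using eq spin by (simp add: eta_mult)
  then have "f * g = k * f \<or> f * g = - (k * f)" using spin by (intro eta_eq_imp spin41p_mult)
  moreover have "f * g \<noteq> - (k * f)"
  proof
    assume neg: "f * g = - (k * f)"
    have "mat_trace_4 g = mat_trace_4 (h * (f * g))"
      using carr hc h by (simp flip: assoc_mult_mat[of _ 4 4 _ 4 _ 4])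
    also have "\<dots> = mat_trace_4 (f * g * h)" using carr hc by (intro mat_trace_4_commute) auto
    also have "\<dots> = - mat_trace_4 (k * f * h)"
      unfolding neg using carr hc by (simp add: mat_trace_4_uminus mult_carrier_mat[of _ 4 4])
    also have "k * f * h = k" using carr hc h by simp
    finally show False
      using congruence_group_trace_neq_uminus davis_spin_group_congruence g k by blast
  qed
  ultimately show ?thesis by blast
qed

text \<open>Any lift of \<open>f\<close> works. Each inclusion for the lifted group comes from the
  one for \<open>davis_Gamma\<close>, where \<open>davis_spin_group_conjugate\<close> removes the
  ambiguity of sign.\<close>

lemma fully_symmetric_davis: "fully_symmetric davis_spin_group"
  unfolding fully_symmetric_def
proof
  fix f assume f: "f \<in> normalizer_in SO41p davis_Gamma"
  then have "f \<in> SO41p" by (simp add: normalizer_in_def)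
  then obtain fh where fh: "fh \<in> spin41p" "eta fh = f" using eta_surj by blast
  have norm: "(\<lambda>g. f * g) ` davis_Gamma = (\<lambda>g. g * f) ` davis_Gamma"
    using f by (simp add: normalizer_in_def)
  have lift: "eta g \<in> davis_Gamma" if "g \<in> davis_spin_group" for g
    using that eta_davis_spin_group by blast
  have "(\<lambda>g. fh * g) ` davis_spin_group = (\<lambda>g. g * fh) ` davis_spin_group"
  proof (intro equalityI subsetI)
    fix x assume "x \<in> (\<lambda>g. fh * g) ` davis_spin_group"
    then obtain g where g: "g \<in> davis_spin_group" "x = fh * g" by (rule imageE)
    have "f * eta g \<in> (\<lambda>g. g * f) ` davis_Gamma" unfolding norm[symmetric] by (intro imageI lift g)
    then obtain k where k: "k \<in> davis_spin_group" "f * eta g = eta k * f"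
      unfolding eta_davis_spin_group[symmetric] image_image by (rule imageE)
    then have "x = k * fh" using davis_spin_group_conjugate[OF fh(1) g(1) k(1)] fh(2) g(2) by simp
    with k(1) show "x \<in> (\<lambda>g. g * fh) ` davis_spin_group" by (rule rev_image_eqI)
  next
    fix x assume "x \<in> (\<lambda>g. g * fh) ` davis_spin_group"
    then obtain k where k: "k \<in> davis_spin_group" "x = k * fh" by (rule imageE)
    have "eta k * f \<in> (\<lambda>g. f * g) ` davis_Gamma" unfolding norm by (intro imageI lift k)
    then obtain g where g: "g \<in> davis_spin_group" "eta k * f = f * eta g"
      unfolding eta_davis_spin_group[symmetric] image_image by (rule imageE)
    then have "x = fh * g" using davis_spin_group_conjugate[OF fh(1) g(1) k(1)] fh(2) k(2) by simp
    with g(1) show "x \<in> (\<lambda>g. fh * g) ` davis_spin_group" by (rule rev_image_eqI)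
  qed
  with fh show "\<exists>fh\<in>normalizer_in spin41p davis_spin_group. eta fh = f" by (auto simp: normalizer_in_def)
qed

section \<open>Uniqueness\<close>

lemma davis_Gamma_carrier: "g \<in> davis_Gamma \<Longrightarrow> g \<in> carrier_mat 5 5"
  unfolding davis_Gamma_def
  by (rule gen_group_carrier[of davis_side_pairings 5 g]) (simp_all add: davis_side_pairings_symmetric)

text \<open>The lift of a product of two reflections of the 600-cell, which is a rotation of the
  120-cell about its center: both reflections send the time axis to its negative, and the signs
  cancel.\<close>

definition root_rotor :: "golden list \<Rightarrow> golden list \<Rightarrow> complex mat" where
  "root_rotor V W = cliff (golden_vec V) * cliff (golden_vec W)"

lemma simple_root_vec:
  assumes "V \<in> set simple_roots"
  shows "golden_vec V $ 0 = 0" "lform (golden_vec V) (golden_vec V) = 1"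
  using assms simple_roots_icosians cell120_dirsD[of "golden_vec V"] by (auto simp: cell120_dirs_eq)

context
  fixes V W assumes VW: "V \<in> set simple_roots" "W \<in> set simple_roots"
begin

lemma root_rotor_spin41p: "root_rotor V W \<in> spin41p"
  unfolding root_rotor_def using VW by (intro spin41p_pair) (auto simp: simple_root_vec)

lemma eta_root_rotor: "eta (root_rotor V W) = neg_reflection (golden_vec V) * neg_reflection (golden_vec W)"
  unfolding root_rotor_def using VW by (intro eta_pair) (auto simp: simple_root_vec)

lemma eta_root_rotor_time_axis: "eta (root_rotor V W) *\<^sub>v unit_vec 5 0 = unit_vec 5 0"
  using VW
  by (simp add: eta_root_rotor assoc_mult_mat_vec[of _ 5 5 _ 5] neg_reflection_orthogonal
      neg_reflection_minus lform_unit_vec simple_root_vec)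

lemma eta_root_rotor_SO41p: "eta (root_rotor V W) \<in> SO41p"
proof -
  have "eta (root_rotor V W) $$ (0, 0) = (eta (root_rotor V W) *\<^sub>v unit_vec 5 0) $ 0"
    using eta_carrier[OF root_rotor_spin41p] by simp
  then have "eta (root_rotor V W) $$ (0, 0) = 1" by (simp add: eta_root_rotor_time_axis)
  then show ?thesis
    using proper_isometry_eta[OF root_rotor_spin41p] by (simp add: SO41p_def proper_isometry_def)
qed

lemma eta_root_rotor_dirs:
  assumes "X \<in> set icosians"
  shows "eta (root_rotor V W) *\<^sub>v golden_vec X = golden_vec (golden_neg_reflection V (golden_neg_reflection W X))"
  using assms VW
  by (simp add: eta_root_rotor assoc_mult_mat_vec[of _ 5 5 _ 5] golden_neg_reflection_icosian)

text \<open>The spinor is a product of two vectors, and conjugation acts on each through the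
  rotation: the time axis is fixed and the axis of \<open>u\<close> goes to that of the rotated
  \<open>u\<close>. Thus the spinors are permuted exactly, without signs.\<close>

lemma root_rotor_davis_spinor:
  assumes "X \<in> set icosians"
  shows "root_rotor V W * davis_spinor (golden_vec X)
    = davis_spinor (golden_vec (golden_neg_reflection V (golden_neg_reflection W X))) * root_rotor V W"
proof -
  let ?r = "root_rotor V W" and ?u = "golden_vec X" and ?e = "unit_vec 5 0 :: real vec"
  let ?f = "eta ?r"
  have inter: "?r * cliff x = cliff (?f *\<^sub>v x) * ?r" if "x \<in> carrier_vec 5" for x
    using intertwines_eta[OF root_rotor_spin41p] that by (simp add: intertwines_def)
  have rc: "?r \<in> carrier_mat 4 4" and fc: "?f \<in> carrier_mat 5 5"
    using spin41p_carrier eta_carrier root_rotor_spin41p by blast+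
  have "?f *\<^sub>v davis_axis ?u = davis_axis (?f *\<^sub>v ?u)"
    unfolding davis_axis_def using fc
    by (simp add: mult_add_distrib_mat_vec[of _ 5 5] mult_mat_vec[of _ 5 5] eta_root_rotor_time_axis)
  then have "cliff (?f *\<^sub>v davis_axis ?u) * cliff (?f *\<^sub>v ?e) = davis_spinor (?f *\<^sub>v ?u)"
    by (simp add: davis_spinor_def eta_root_rotor_time_axis)
  moreover have "?r * davis_spinor ?u = ?r * cliff (davis_axis ?u) * cliff ?e"
    unfolding davis_spinor_def using rc by (intro assoc_mult_mat[symmetric, of _ 4 4 _ 4 _ 4]) auto
  moreover have "\<dots> = cliff (?f *\<^sub>v davis_axis ?u) * (?r * cliff ?e)"
    using rc by (simp add: inter davis_axis_carrier assoc_mult_mat[of _ 4 4 _ 4 _ 4])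
  moreover have "\<dots> = cliff (?f *\<^sub>v davis_axis ?u) * cliff (?f *\<^sub>v ?e) * ?r"
    using rc by (simp add: inter assoc_mult_mat[of _ 4 4 _ 4 _ 4])
  ultimately show ?thesis using eta_root_rotor_dirs[OF assms] by simp
qed

lemma eta_root_rotor_Gamma:
  assumes "g \<in> davis_Gamma"
  shows "\<exists>g'\<in>davis_Gamma. eta (root_rotor V W) * g = g' * eta (root_rotor V W)"
  using assms unfolding davis_Gamma_def
proof (induction rule: gen_group_induct_symmetric)
  case (symmetric s)
  then show ?case by (rule davis_side_pairings_symmetric)
next
  case one
  then show ?case using eta_carrier[OF root_rotor_spin41p] by (intro bexI[of _ "1\<^sub>m 5"]) (auto intro: gen_group.one)
next
  case (mult g s)
  let ?r = "root_rotor V W"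
  obtain g' where g': "g' \<in> gen_group 5 davis_side_pairings" "eta ?r * g = g' * eta ?r" using mult by blast
  obtain X where X: "X \<in> set icosians" "s = eta (davis_spinor (golden_vec X))"
    using mult.hyps by (auto simp: davis_side_pairings_eq davis_spinors_def cell120_dirs_eq)
  let ?Y = "golden_neg_reflection V (golden_neg_reflection W X)"
  have Y: "?Y \<in> set icosians" using golden_neg_reflection_icosian VW X by blast
  define s' where "s' = eta (davis_spinor (golden_vec ?Y))"
  have spinors: "davis_spinor (golden_vec X) \<in> davis_spinors" "davis_spinor (golden_vec ?Y) \<in> davis_spinors"
    using X Y by (auto simp: davis_spinors_def cell120_dirs_eq)
  then have s': "s' \<in> davis_side_pairings" by (simp add: s'_def davis_side_pairings_eq)
  have rs: "eta ?r * s = s' * eta ?r"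
    unfolding X(2) s'_def using root_rotor_davis_spinor[OF X(1)]
    by (simp only: eta_mult[OF root_rotor_spin41p davis_spinors_spin41p[OF spinors(1)], symmetric]
        eta_mult[OF davis_spinors_spin41p[OF spinors(2)] root_rotor_spin41p, symmetric])
  have carr: "eta ?r \<in> carrier_mat 5 5" "s \<in> carrier_mat 5 5" "s' \<in> carrier_mat 5 5" "g \<in> carrier_mat 5 5" "g' \<in> carrier_mat 5 5"
    using eta_carrier[OF root_rotor_spin41p] davis_side_pairings_symmetric[OF mult.hyps(2)]
      davis_side_pairings_symmetric[OF s'] davis_Gamma_carrier mult.hyps(1) g'(1)
    by (simp_all add: davis_Gamma_def)
  have "eta ?r * (s * g) = eta ?r * s * g" using carr by (simp add: assoc_mult_mat[of _ 5 5 _ 5 _ 5])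
  also have "\<dots> = s' * (eta ?r * g)" unfolding rs using carr by (simp add: assoc_mult_mat[of _ 5 5 _ 5 _ 5])
  also have "\<dots> = s' * g' * eta ?r" unfolding g'(2) using carr by (simp add: assoc_mult_mat[of _ 5 5 _ 5 _ 5])
  finally show ?case using gen_group.mult[OF g'(1) s'] by blast
qed

end

text \<open>\<open>eta_root_rotor_Gamma\<close> yields one inclusion. Exchanging \<open>V\<close>
  and \<open>W\<close> gives the inverse rotation, and with it the other inclusion.\<close>

lemma eta_root_rotor_normalizer:
  assumes VW: "V \<in> set simple_roots" "W \<in> set simple_roots"
  shows "eta (root_rotor V W) \<in> normalizer_in SO41p davis_Gamma"
proof -
  let ?f = "eta (root_rotor V W)" and ?h = "eta (root_rotor W V)"
  have "root_rotor V W * root_rotor W V = 1\<^sub>m 4" "root_rotor W V * root_rotor V W = 1\<^sub>m 4"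
    unfolding root_rotor_def using VW by (auto intro!: cliff_pair_inverse simp: simple_root_vec)
  then have fh: "?f * ?h = 1\<^sub>m 5" "?h * ?f = 1\<^sub>m 5"
    using eta_mult[OF root_rotor_spin41p[OF VW] root_rotor_spin41p[OF VW(2,1)]]
      eta_mult[OF root_rotor_spin41p[OF VW(2,1)] root_rotor_spin41p[OF VW]] eta_one by simp_all
  have carr: "?f \<in> carrier_mat 5 5" "?h \<in> carrier_mat 5 5" using VW eta_carrier root_rotor_spin41p by blast+
  have "(\<lambda>g. ?f * g) ` davis_Gamma = (\<lambda>g. g * ?f) ` davis_Gamma"
  proof (intro equalityI subsetI)
    fix x assume "x \<in> (\<lambda>g. ?f * g) ` davis_Gamma"
    then obtain g where g: "g \<in> davis_Gamma" "x = ?f * g" by (rule imageE) simp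
    obtain g' where "g' \<in> davis_Gamma" "?f * g = g' * ?f" using eta_root_rotor_Gamma[OF VW g(1)] by blast
    with g(2) show "x \<in> (\<lambda>g. g * ?f) ` davis_Gamma" by simp
  next
    fix x assume "x \<in> (\<lambda>g. g * ?f) ` davis_Gamma"
    then obtain g where g: "g \<in> davis_Gamma" "x = g * ?f" by blast
    obtain g' where g': "g' \<in> davis_Gamma" "?h * g = g' * ?h" using eta_root_rotor_Gamma[OF VW(2,1) g(1)] by blast
    note c = carr davis_Gamma_carrier[OF g(1)] davis_Gamma_carrier[OF g'(1)]
    have "x = ?f * ?h * (g * ?f)" unfolding fh(1) g(2) using c by simp
    also have "\<dots> = ?f * (?h * g) * ?f" using c by (simp add: assoc_mult_mat[of _ 5 5 _ 5 _ 5])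
    also have "\<dots> = ?f * g' * (?h * ?f)" unfolding g'(2) using c by (simp add: assoc_mult_mat[of _ 5 5 _ 5 _ 5])
    also have "\<dots> = ?f * g'" unfolding fh(2) using c by simp
    finally show "x \<in> (\<lambda>g. ?f * g) ` davis_Gamma" using g' by blast
  qed
  with eta_root_rotor_SO41p[OF VW] show ?thesis by (simp add: normalizer_in_def)
qed

section \<open>One sign for all generators\<close>

lemma spin41p_cancel_right:
  assumes "a * g = b * g" "g \<in> spin41p" "a \<in> carrier_mat 4 4" "b \<in> carrier_mat 4 4"
  shows "a = b"
proof -
  obtain h where h: "h \<in> spin41p" "g * h = 1\<^sub>m 4" using spin41p_inverse[OF assms(2)] by blast
  note carr = spin41p_carrier[OF h(1)] spin41p_carrier[OF assms(2)]
  have "a * (g * h) = a * g * h" "b * (g * h) = b * g * h"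
    using assms(3,4) carr by (auto intro: assoc_mult_mat[symmetric])
  then show ?thesis using assms h(2) by simp
qed

text \<open>Full symmetry supplies some lift of the rotation, which is plus or minus the rotor. The
  sign cancels under conjugation, so the coefficient \<open>c\<close> is carried unchanged to every
  direction.\<close>

lemma fully_symmetric_spinor_orbit:
  assumes G: "is_spin_structure G" "fully_symmetric G" and X: "X \<in> set icosians"
    and start: "c \<cdot>\<^sub>m davis_spinor (golden_vec [(2,0),(0,0),(0,0),(0,0)]) \<in> G"
  shows "c \<cdot>\<^sub>m davis_spinor (golden_vec X) \<in> G"
  using X
proof (induction rule: icosians_double_reflection_induct[consumes 1, case_names base step])
  case base
  then show ?case by (rule start)
next
  case (step V W X)
  let ?r = "root_rotor V W" and ?S = "davis_spinor (golden_vec X)"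
    and ?S' = "davis_spinor (golden_vec (golden_neg_reflection V (golden_neg_reflection W X)))"
  obtain fh where fh: "fh \<in> normalizer_in spin41p G" "eta fh = eta ?r"
    using bspec[OF G(2)[unfolded fully_symmetric_def] eta_root_rotor_normalizer[OF step(1,2)]] by (rule bexE)
  then have spin: "fh \<in> spin41p" and norm: "(\<lambda>g. fh * g) ` G = (\<lambda>g. g * fh) ` G"
    by (simp_all add: normalizer_in_def)
  have r: "?r \<in> spin41p" by (rule root_rotor_spin41p[OF step(1,2)])
  note carr = spin41p_carrier[OF r] spin41p_carrier[OF spin]
  have comm: "fh * ?S = ?S' * fh"
    using eta_eq_imp[OF spin r fh(2)]
  proof
    assume "fh = ?r"
    then show ?thesis using root_rotor_davis_spinor[OF step(1,2,3)] by (simp only:)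
  next
    assume neg: "fh = - ?r"
    have "- ?r * ?S = - (?r * ?S)"
      using carrier_matD[OF carr(1)] carrier_matD[OF davis_spinor_carrier] by (intro uminus_mult_left_mat) simp
    moreover have "?S' * - ?r = - (?S' * ?r)"
      using carrier_matD[OF carr(1)] carrier_matD[OF davis_spinor_carrier] by (intro uminus_mult_right_mat) simp
    ultimately show ?thesis unfolding neg using root_rotor_davis_spinor[OF step(1,2,3)] by (simp only:)
  qed
  have "fh * (c \<cdot>\<^sub>m ?S) \<in> (\<lambda>g. g * fh) ` G"
    unfolding norm[symmetric] by (intro imageI step(4))
  then obtain g where g: "g \<in> G" "fh * (c \<cdot>\<^sub>m ?S) = g * fh" by (rule imageE) simp
  have "g * fh = c \<cdot>\<^sub>m (fh * ?S)"
    unfolding g(2)[symmetric] using carr by (intro mult_smult_distrib[of _ 4 4 _ 4]) auto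
  also have "\<dots> = (c \<cdot>\<^sub>m ?S') * fh"
    unfolding comm using carr by (intro mult_smult_assoc_mat[symmetric, of _ 4 4 _ 4]) auto
  finally have eq: "g * fh = (c \<cdot>\<^sub>m ?S') * fh" .
  have "g \<in> carrier_mat 4 4" using g(1) G(1) spin41p_carrier unfolding is_spin_structure_def by blast
  then have "g = c \<cdot>\<^sub>m ?S'" using spin41p_cancel_right[OF eq spin] by simp
  with g(1) show ?case by (simp only:)
qed

text \<open>The elements 1 and -1 have the same image under \<open>eta\<close>, which is injective
  on a spin structure.\<close>

lemma spin_structure_not_uminus_one:
  assumes "is_spin_structure G"
  shows "- 1\<^sub>m 4 \<notin> G"
proof
  assume neg: "- 1\<^sub>m 4 \<in> G"
  then have spin: "- 1\<^sub>m 4 \<in> spin41p" using assms by (auto simp: is_spin_structure_def)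
  have "intertwines (- 1\<^sub>m 4) (1\<^sub>m 5)"
    by (simp add: intertwines_def left_mult_one_mat[of _ 4 4] right_mult_one_mat[of _ 4 4])
  then have "eta (- 1\<^sub>m 4) = eta (1\<^sub>m 4)" using spin by (simp add: eta_eqI eta_one)
  with neg assms have "- 1\<^sub>m 4 = (1\<^sub>m 4 :: complex mat)"
    by (auto simp: is_spin_structure_def dest: inj_onD)
  then have "(- 1\<^sub>m 4) $$ (0, 0) = (1\<^sub>m 4 :: complex mat) $$ (0, 0)" by simp
  then show False by simp
qed

lemma fully_symmetric_unique:
  assumes G: "is_spin_structure G" "fully_symmetric G"
  shows "G = davis_spin_group"
proof -
  have sub: "G \<subseteq> spin41p" and one: "1\<^sub>m 4 \<in> G" and inj: "inj_on eta G" and image: "eta ` G = davis_Gamma"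
    and mult: "\<And>g h. g \<in> G \<Longrightarrow> h \<in> G \<Longrightarrow> g * h \<in> G"
    using G(1) by (auto simp: is_spin_structure_def)
  let ?S0 = "davis_spinor (golden_vec [(2,0),(0,0),(0,0),(0,0)])"
  have "[(2,0),(0,0),(0,0),(0,0)] \<in> set icosians"
    using simple_roots_icosians by (simp add: simple_roots_def)
  then have S0: "?S0 \<in> davis_spinors" by (auto simp: davis_spinors_def cell120_dirs_eq)
  then have "eta ?S0 * 1\<^sub>m 5 \<in> davis_Gamma"
    unfolding davis_Gamma_def davis_side_pairings_eq by (intro gen_group.mult gen_group.one imageI)
  moreover have "eta ?S0 \<in> carrier_mat 5 5" using S0 eta_carrier davis_spinors_spin41p by blast
  ultimately have "eta ?S0 \<in> davis_Gamma" by simp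
  then obtain g where g: "g \<in> G" "eta g = eta ?S0" using image by (metis imageE)
  then have "g = ?S0 \<or> g = - ?S0" using sub S0 davis_spinors_spin41p by (intro eta_eq_imp) auto
  moreover have "g \<noteq> - ?S0"
  proof
    assume "g = - ?S0"
    moreover have "(- 1) \<cdot>\<^sub>m ?S0 = - ?S0" by (intro eq_matI) auto
    ultimately have "(- 1) \<cdot>\<^sub>m ?S0 \<in> G" using g(1) by simp
    then have S: "(- 1) \<cdot>\<^sub>m davis_spinor (golden_vec X) \<in> G" if "X \<in> set icosians" for X
      using fully_symmetric_spinor_orbit[OF G] that by blast
    obtain X0 X1 X2 X3 X4 where X: "set [X0, X1, X2, X3, X4] \<subseteq> set icosians"
      and rel: "davis_spinor (golden_vec X0) * davis_spinor (golden_vec X1) * davis_spinor (golden_vec X2)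
       * davis_spinor (golden_vec X3) * davis_spinor (golden_vec X4) = 1\<^sub>m 4"
      using davis_spinor_pentagram by blast
    have neg: "((- 1) \<cdot>\<^sub>m a) * ((- 1) \<cdot>\<^sub>m b) = a * b" "a * ((- 1) \<cdot>\<^sub>m b) = - (a * b)"
      if "a \<in> carrier_mat 4 4" "b \<in> carrier_mat 4 4" for a b :: "complex mat"
      using that by (auto intro!: eq_matI simp: mult_smult_distrib[of _ 4 4 _ 4] mult_smult_assoc_mat[of _ 4 4 _ 4]
          simp del: index_mult_mat(1))
    let ?N = "\<lambda>X. (- 1) \<cdot>\<^sub>m davis_spinor (golden_vec X)"
    \<comment> \<open>Of the five signs four cancel in pairs; the fifth turns the ridge relation
      into -1.\<close>
    have "(?N X0 * ?N X1) * (?N X2 * ?N X3) * ?N X4 \<in> G"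
      using X by (intro mult S) auto
    also have "?N X0 * ?N X1 = davis_spinor (golden_vec X0) * davis_spinor (golden_vec X1)"
      by (rule neg) simp_all
    also have "?N X2 * ?N X3 = davis_spinor (golden_vec X2) * davis_spinor (golden_vec X3)"
      by (rule neg) simp_all
    also have "davis_spinor (golden_vec X0) * davis_spinor (golden_vec X1)
        * (davis_spinor (golden_vec X2) * davis_spinor (golden_vec X3)) * ?N X4
      = - (davis_spinor (golden_vec X0) * davis_spinor (golden_vec X1)
        * (davis_spinor (golden_vec X2) * davis_spinor (golden_vec X3)) * davis_spinor (golden_vec X4))"
      by (rule neg) (simp_all add: mult_carrier_mat[of _ 4 4])
    also have "\<dots> = - 1\<^sub>m 4"
      using rel by (simp add: mult_carrier_mat[of _ 4 4] assoc_mult_mat[of _ 4 4 _ 4 _ 4])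
    finally show False using spin_structure_not_uminus_one[OF G(1)] by blast
  qed
  ultimately have "?S0 \<in> G" using g by blast
  moreover have one_smult: "1 \<cdot>\<^sub>m a = a" for a :: "complex mat" by (intro eq_matI) auto
  ultimately have S: "davis_spinor (golden_vec X) \<in> G" if "X \<in> set icosians" for X
    using fully_symmetric_spinor_orbit[OF G that, of 1] by simp
  have "davis_spin_group \<subseteq> G"
  proof
    fix h assume "h \<in> davis_spin_group"
    then show "h \<in> G"
      by (induction rule: davis_spin_group_induct) (auto simp: davis_spinors_def cell120_dirs_eq intro: one mult S)
  qed
  \<comment> \<open>Both groups have the image \<open>davis_Gamma\<close> and \<open>eta\<close> is
    injective on \<open>G\<close>, so the inclusion is an equality.\<close>
  moreover have "g \<in> davis_spin_group" if "g \<in> G" for g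
  proof -
    have "eta g \<in> eta ` davis_spin_group" using that image eta_davis_spin_group by blast
    then obtain h where h: "h \<in> davis_spin_group" "eta g = eta h" by (rule imageE) simp
    with \<open>davis_spin_group \<subseteq> G\<close> have "g = h" using inj_onD[OF inj h(2) that] by blast
    with h show ?thesis by simp
  qed
  ultimately show ?thesis by blast
qed

theorem theorem3p2:
  shows "\<exists>!G. is_spin_structure G \<and> fully_symmetric G"
  using is_spin_structure_davis fully_symmetric_davis fully_symmetric_unique by blast

end
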